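(* Let $1<p<\infty$ and let $(K,\{F_i\}_{i=1}^N)$ be an affine nested fractal, with $\mathscr G$ the symmetry group generated by the reflections $\{\sigma_{x,y}:x\ne y\in V_0\}$. If the renormalization factor $\boldsymbol r=(r_1,\dots,r_N)$ (a positive vector) is $\mathscr G$-symmetric, then there exists $E\in\mathcal M$ such that $\inf_{n\ge0}\delta(\mathcal T^nE)>0$.
   Context: Discrete energies. Fix $1<p<\infty$. For a set $X$, $l(X)$ is the space of real-valued functions on $X$. For a finite set $A$ with $\#A\ge2$, $\mathcal M_p(A)$ is the set of functionals $E:l(A)\to\mathbb R$ such that for all $f,g\in l(A)$: (i) $E(f)\ge0$; (ii) $E(tf+(1-t)g)\le tE(f)+(1-t)E(g)$ for $t\in(0,1)$; (iii) $E(tf)=|t|^pE(f)$ for $t\in\mathbb R$; (iv) $E(f+t)=E(f)$ for $t\in\mathbb R$; (v) $E((f\vee0)\wedge1)\le E(f)$; (vi) $E(f)=0$ iff $f$ is constant. For $B\subset A$, the trace of $E$ to $B$ is $[E]_B(f)=\inf\{E(f'):f'\in l(A),f'|_B=f\}$, $f\in l(B)$. The $p$-resistance of $E$ is $R(x,y)=1/\inf\{E(f):f(x)=0,f(y)=1\}$ for $x\ne y$, $R(x,x)=0$. Fractals. $F_i(x)=\alpha_iU_ix+a_i$, $1\le i\le N$, $N\ge2$, are similitudes of $\mathbb R^d$ with $\alpha_i\in(0,1)$, $U_i$ orthogonal, $a_i\in\mathbb R^d$; $K$ is the unique non-empty compact set with $K=\bigcup_iF_iK$, assumed connected. $W_n=\{1,\dots,N\}^n$,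 $W_0=\{\emptyset\}$; for $w=w_1\cdots w_n$, $F_w=F_{w_1}\circ\cdots\circ F_{w_n}$. $\Sigma=\{1,\dots,N\}^{\mathbb N}$, $\pi:\Sigma\to K$ with $\{\pi(\omega)\}=\bigcap_nF_{\omega_1\cdots\omega_n}K$, $\tau$ is the left shift on $\Sigma$, $\mathcal C=\pi^{-1}(\bigcup_{i\ne j}(F_iK\cap F_jK))$, $\mathcal P=\bigcup_{m\ge1}\tau^m(\mathcal C)$. $K$ is p.c.f. if $\mathcal P$ is finite. $V_0=\pi(\mathcal P)$, $V_n=\bigcup_iF_iV_{n-1}$. $\mathcal M=\mathcal M_p(V_0)$. Renormalization. For $E\in\mathcal M$, $\Lambda E\in\mathcal M_p(V_1)$ is $\Lambda E(f)=\sum_{i=1}^Nr_i^{-1}E(f\circ F_i)$ and $\mathcal TE=[\Lambda E]_{V_0}$. For $E\in\mathcal M$ with $p$-resistance $R$, $\delta(E)=\min_{x\ne y\in V_0}R(x,y)/\max_{x\ne y\in V_0}R(x,y)$. Symmetry. For a finite group $\mathscr G$ of homeomorphisms $K\to K$, $(K,\{F_i\})$ is $\mathscr G$-symmetric if for any $\sigma\in\mathscr G$, $n\ge0$ there is a permutation $\sigma^{(n)}$ of $W_n$ with $\sigma(F_wK)=F_{\sigma^{(n)}(w)}K$ and $\sigma(F_wV_0)=F_{\sigma^{(n)}(w)}V_0$ for all $w\in W_n$. $\boldsymbol r$ is $\mathscr G$-symmetric if $r_i=r_{\sigma^{(1)}(i)}$ for all $1\le i\le N$, $\sigma\in\mathscr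 G$. For $x\ne y\in\mathbb R^d$, $\sigma_{x,y}$ is the reflection in the hyperplane $\{z\in\mathbb R^d:|x-z|=|y-z|\}$. A p.c.f. self-similar set $(K,\{F_i\})$ is an affine nested fractal if it is $\mathscr G$-symmetric for the group $\mathscr G$ generated by $\{\sigma_{x,y}:x\ne y\in V_0\}$ (restricted to $K$). *)

theory Defs
  imports "HOL-Analysis.Analysis" "HOL-Algebra.Bij" "HOL-Algebra.Generated_Groups"
begin

section \<open>Discrete energies\<close>

text \<open>
  A functional on l(A), the space of real functions on the set A, is encoded as a functional on
  all functions of type \<open>'a \<Rightarrow> real\<close> that depends only on the restriction of its
  argument to A (first clause below). Such functionals correspond bijectively to functionals
  on l(A), and restrictions and extensions of functions need not be written out.
\<close>

definition energies :: "real \<Rightarrow> 'a set \<Rightarrow> (('a \<Rightarrow> real) \<Rightarrow> real) set" where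
  "energies p A = {E.
     (\<forall>f g. (\<forall>x\<in>A. f x = g x) \<longrightarrow> E f = E g) \<and>
     (\<forall>f. 0 \<le> E f) \<and>
     (\<forall>f g t. 0 < t \<and> t < 1 \<longrightarrow>
        E (\<lambda>x. t * f x + (1 - t) * g x) \<le> t * E f + (1 - t) * E g) \<and>
     (\<forall>f t. E (\<lambda>x. t * f x) = \<bar>t\<bar> powr p * E f) \<and>
     (\<forall>f t. E (\<lambda>x. f x + t) = E f) \<and>
     (\<forall>f. E (\<lambda>x. min (max (f x) 0) 1) \<le> E f) \<and>
     (\<forall>f. E f = 0 \<longleftrightarrow> (\<exists>c. \<forall>x\<in>A. f x = c))}"

definition energy_trace :: "'a set \<Rightarrow> (('a \<Rightarrow> real) \<Rightarrow> real) \<Rightarrow> ('a \<Rightarrow> real) \<Rightarrow> real" where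
  "energy_trace B E f = Inf {E f' | f'. \<forall>x\<in>B. f' x = f x}"

definition resistance :: "(('a \<Rightarrow> real) \<Rightarrow> real) \<Rightarrow> 'a \<Rightarrow> 'a \<Rightarrow> real" where
  "resistance E x y = (if x = y then 0 else 1 / Inf {E f | f. f x = 0 \<and> f y = 1})"

definition resistance_ratio :: "'a set \<Rightarrow> (('a \<Rightarrow> real) \<Rightarrow> real) \<Rightarrow> real" where
  "resistance_ratio A E =
     Min {resistance E x y | x y. x \<in> A \<and> y \<in> A \<and> x \<noteq> y} /
     Max {resistance E x y | x y. x \<in> A \<and> y \<in> A \<and> x \<noteq> y}"


section \<open>Post-critically finite self-similar sets\<close>

definition similitude :: "('a::euclidean_space \<Rightarrow> 'a) \<Rightarrow> bool" where
  "similitude f \<longleftrightarrow> (\<exists>\<alpha> U a. 0 < \<alpha> \<and> \<alpha> < 1 \<and> orthogonal_transformation U \<and>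
     (\<forall>x. f x = \<alpha> *\<^sub>R U x + a))"

text \<open>By contractivity, at most one set K satisfies this predicate for given N and F.\<close>

definition self_similar_set :: "nat \<Rightarrow> (nat \<Rightarrow> 'a::euclidean_space \<Rightarrow> 'a) \<Rightarrow> 'a set \<Rightarrow> bool" where
  "self_similar_set N F K \<longleftrightarrow>
     2 \<le> N \<and> (\<forall>i\<in>{1..N}. similitude (F i)) \<and>
     K \<noteq> {} \<and> compact K \<and> K = (\<Union>i\<in>{1..N}. F i ` K) \<and> connected K"

definition words :: "nat \<Rightarrow> nat \<Rightarrow> nat list set" where
  "words N n = {w. length w = n \<and> set w \<subseteq> {1..N}}"

primrec word_map :: "(nat \<Rightarrow> 'a \<Rightarrow> 'a) \<Rightarrow> nat list \<Rightarrow> 'a \<Rightarrow> 'a" where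
  "word_map F [] = id"
| "word_map F (i # w) = F i \<circ> word_map F w"

definition code_space :: "nat \<Rightarrow> (nat \<Rightarrow> nat) set" where
  "code_space N = UNIV \<rightarrow> {1..N}"

text \<open>Infinite words are indexed from 0, so that \<open>\<omega> 0\<close> is the first letter of \<open>\<omega>\<close>.\<close>

definition coding_map :: "(nat \<Rightarrow> 'a \<Rightarrow> 'a) \<Rightarrow> 'a set \<Rightarrow> (nat \<Rightarrow> nat) \<Rightarrow> 'a" where
  "coding_map F K \<omega> = (THE x. (\<Inter>n. word_map F (map \<omega> [0..<n]) ` K) = {x})"

definition left_shift :: "(nat \<Rightarrow> nat) \<Rightarrow> nat \<Rightarrow> nat" where
  "left_shift \<omega> = (\<lambda>n. \<omega> (Suc n))"

definition critical_set :: "nat \<Rightarrow> (nat \<Rightarrow> 'a \<Rightarrow> 'a) \<Rightarrow> 'a set \<Rightarrow> (nat \<Rightarrow> nat) set" where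
  "critical_set N F K = {\<omega> \<in> code_space N.
     \<exists>i\<in>{1..N}. \<exists>j\<in>{1..N}. i \<noteq> j \<and> coding_map F K \<omega> \<in> F i ` K \<inter> F j ` K}"

definition postcritical_set :: "nat \<Rightarrow> (nat \<Rightarrow> 'a \<Rightarrow> 'a) \<Rightarrow> 'a set \<Rightarrow> (nat \<Rightarrow> nat) set" where
  "postcritical_set N F K = (\<Union>m\<in>{1..}. (left_shift ^^ m) ` critical_set N F K)"

definition pcf :: "nat \<Rightarrow> (nat \<Rightarrow> 'a \<Rightarrow> 'a) \<Rightarrow> 'a set \<Rightarrow> bool" where
  "pcf N F K \<longleftrightarrow> finite (postcritical_set N F K)"

primrec vertices :: "nat \<Rightarrow> (nat \<Rightarrow> 'a \<Rightarrow> 'a) \<Rightarrow> 'a set \<Rightarrow> nat \<Rightarrow> 'a set" where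
  "vertices N F K 0 = coding_map F K ` postcritical_set N F K"
| "vertices N F K (Suc n) = (\<Union>i\<in>{1..N}. F i ` vertices N F K n)"


section \<open>Renormalization\<close>

definition replicate_energy ::
  "nat \<Rightarrow> (nat \<Rightarrow> 'a \<Rightarrow> 'a) \<Rightarrow> (nat \<Rightarrow> real) \<Rightarrow> (('a \<Rightarrow> real) \<Rightarrow> real) \<Rightarrow> ('a \<Rightarrow> real) \<Rightarrow> real" where
  "replicate_energy N F r E f = (\<Sum>i=1..N. inverse (r i) * E (f \<circ> F i))"

text \<open>For E a functional on \<open>l(V\<^sub>0)\<close>, the result is a functional on \<open>l(V\<^sub>1)\<close>:\<close>

lemma replicate_energy_cong:
  assumes "E \<in> energies p (vertices N F K 0)"
    and "\<And>x. x \<in> vertices N F K (Suc 0) \<Longrightarrow> f x = g x"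
  shows "replicate_energy N F r E f = replicate_energy N F r E g"
proof -
  have "E (f \<circ> F i) = E (g \<circ> F i)" if "i \<in> {1..N}" for i
  proof -
    have "\<forall>x\<in>vertices N F K 0. (f \<circ> F i) x = (g \<circ> F i) x"
      using assms(2) that unfolding vertices.simps(2) comp_def by blast
    then show ?thesis
      using assms(1) unfolding energies_def by blast
  qed
  then show ?thesis
    by (simp add: replicate_energy_def)
qed

definition renormalize ::
  "nat \<Rightarrow> (nat \<Rightarrow> 'a \<Rightarrow> 'a) \<Rightarrow> 'a set \<Rightarrow> (nat \<Rightarrow> real) \<Rightarrow>
   (('a \<Rightarrow> real) \<Rightarrow> real) \<Rightarrow> ('a \<Rightarrow> real) \<Rightarrow> real" where
  "renormalize N F K r E = energy_trace (vertices N F K 0) (replicate_energy N F r E)"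


section \<open>Symmetry\<close>

definition induces_word_perm ::
  "nat \<Rightarrow> (nat \<Rightarrow> 'a \<Rightarrow> 'a) \<Rightarrow> 'a set \<Rightarrow> ('a \<Rightarrow> 'a) \<Rightarrow> nat \<Rightarrow> (nat list \<Rightarrow> nat list) \<Rightarrow> bool" where
  "induces_word_perm N F K \<sigma> n s \<longleftrightarrow>
     bij_betw s (words N n) (words N n) \<and>
     (\<forall>w\<in>words N n.
        \<sigma> ` (word_map F w ` K) = word_map F (s w) ` K \<and>
        \<sigma> ` (word_map F w ` vertices N F K 0) = word_map F (s w) ` vertices N F K 0)"

text \<open>
  Homeomorphisms of K are encoded as elements of the group \<open>BijGroup K\<close>, that is, they are
  extensional on K.
\<close>

definition symmetric_fractal ::
  "nat \<Rightarrow> (nat \<Rightarrow> 'a::euclidean_space \<Rightarrow> 'a) \<Rightarrow> 'a set \<Rightarrow> ('a \<Rightarrow> 'a) set \<Rightarrow> bool" where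
  "symmetric_fractal N F K G \<longleftrightarrow>
     finite G \<and> subgroup G (BijGroup K) \<and>
     (\<forall>\<sigma>\<in>G. \<exists>\<rho>. homeomorphism K K \<sigma> \<rho>) \<and>
     (\<forall>\<sigma>\<in>G. \<forall>n. \<exists>s. induces_word_perm N F K \<sigma> n s)"

text \<open>
  For an infinite p.c.f. set the permutation s is uniquely determined by \<open>\<sigma>\<close>, as distinct cells
  of the same level are distinct sets. Words of length one are singleton lists, hence the \<open>hd\<close>.
\<close>

definition symmetric_weights ::
  "nat \<Rightarrow> (nat \<Rightarrow> 'a \<Rightarrow> 'a) \<Rightarrow> 'a set \<Rightarrow> ('a \<Rightarrow> 'a) set \<Rightarrow> (nat \<Rightarrow> real) \<Rightarrow> bool" where
  "symmetric_weights N F K G r \<longleftrightarrow>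
     (\<forall>\<sigma>\<in>G. \<exists>s. induces_word_perm N F K \<sigma> 1 s \<and> (\<forall>i\<in>{1..N}. r i = r (hd (s [i]))))"

definition bisector_reflection :: "'a::euclidean_space \<Rightarrow> 'a \<Rightarrow> 'a \<Rightarrow> 'a" where
  "bisector_reflection x y z =
     z - (2 * ((z - midpoint x y) \<bullet> (x - y)) / ((x - y) \<bullet> (x - y))) *\<^sub>R (x - y)"

text \<open>This is the reflection in the hyperplane of the points equidistant from x and y:\<close>

lemma bisector_reflection_swap:
  assumes "x \<noteq> y"
  shows "bisector_reflection x y x = y"
proof -
  have *: "x - midpoint x y = (1/2) *\<^sub>R (x - y)"
    by (simp add: midpoint_def algebra_simps flip: scaleR_left.add)
  show ?thesis
    using assms by (simp add: bisector_reflection_def *)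
qed

lemma bisector_reflection_fixed_iff:
  assumes "x \<noteq> y"
  shows "bisector_reflection x y z = z \<longleftrightarrow> dist x z = dist y z"
proof -
  have "(dist x z)\<^sup>2 - (dist y z)\<^sup>2 = - 2 * ((z - midpoint x y) \<bullet> (x - y))"
    by (simp add: dist_norm power2_norm_eq_inner midpoint_def algebra_simps inner_commute)
  moreover have "dist x z = dist y z \<longleftrightarrow> (dist x z)\<^sup>2 - (dist y z)\<^sup>2 = 0"
    by simp
  ultimately show ?thesis
    using assms by (simp add: bisector_reflection_def)
qed

text \<open>The group is generated inside the bijections of the ambient space, then restricted to K.\<close>

definition reflection_group :: "nat \<Rightarrow> (nat \<Rightarrow> 'a::euclidean_space \<Rightarrow> 'a) \<Rightarrow> 'a set \<Rightarrow> ('a \<Rightarrow> 'a) set" where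
  "reflection_group N F K =
     (\<lambda>\<sigma>. restrict \<sigma> K) `
       generate (BijGroup UNIV)
         {bisector_reflection x y | x y. x \<in> vertices N F K 0 \<and> y \<in> vertices N F K 0 \<and> x \<noteq> y}"

definition affine_nested_fractal :: "nat \<Rightarrow> (nat \<Rightarrow> 'a::euclidean_space \<Rightarrow> 'a) \<Rightarrow> 'a set \<Rightarrow> bool" where
  "affine_nested_fractal N F K \<longleftrightarrow>
     self_similar_set N F K \<and> pcf N F K \<and> symmetric_fractal N F K (reflection_group N F K)"

end

theory Submission
  imports Defs
begin

text \<open>
  Write \<open>E\<^sub>n\<close> for the n-th renormalization of the energy \<open>E\<^sub>0 = (osc f) powr p\<close>, where osc is the
  oscillation on \<open>V\<^sub>0\<close>. The conductance of a pair is the reciprocal of its resistance, the infimum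
  of the energies of the functions with the values 0 and 1 at its points. The theorem says that
  the conductances of any two pairs are comparable, uniformly in n. Two facts give this.

  Moving one end of a pair away from the other increases the conductance at most by a constant
  factor C. If y is at least as close to x as z is, take a test function f for the pair
  \<open>(x, y)\<close> and polarize it: in each pair of points exchanged by the reflection between y and z,
  give the larger value to the point on the side of z. The value at z is then at least
  \<open>f y\<close>, and the value at x is at most \<open>f x\<close>, as x lies on the side of y. The price is that
  polarization multiplies \<open>E\<^sub>n\<close> by at most C (\<open>energy_polarize_le\<close>). The proof is by induction on n
  over the cells of the first level. For a cell that is mapped to itself, the reflection is again
  one between boundary points of the cell. Cells that are exchanged may lie on both sides of
  the hyperplane, but they meet it in boundary points only. On the smallest cells, polarization is then
  a maximum or a minimum of f and its mirror image, or else the ranges of these two functions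
  overlap, so that the oscillation at most adds up (\<open>energy_mix_le\<close>). Both estimates are sums over
  cells with one and the same constant, which therefore does not depend on n.

  Moreover, \<open>V\<^sub>0\<close> is connected by pairs at the minimal distance (\<open>neighbours_connected\<close>). So a
  test function of any pair jumps by a definite amount across a pair of nearest neighbours, which
  a symmetry moves to any given point, and from there one passes to any other pair by the
  first fact.

  Symmetry of the weights concerns the cells of the first level, and the maps of the cells need not be
  compatible with the reflections. What makes \<open>E\<^sub>n\<close> invariant for all n is that every isometry
  of \<open>V\<^sub>0\<close> is a product of reflections between points of \<open>V\<^sub>0\<close> (\<open>invariant_under_isometries\<close>).
\<close>

section \<open>Oscillation energies\<close>

definition osc :: "'a set \<Rightarrow> ('a \<Rightarrow> real) \<Rightarrow> real" where
  "osc V f = Max ((\<lambda>(x, y). \<bar>f x - f y\<bar>) ` (V \<times> V))"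

lemma osc_upper:
  assumes "finite V" "x \<in> V" "y \<in> V"
  shows "\<bar>f x - f y\<bar> \<le> osc V f"
  unfolding osc_def using assms by (intro Max_ge) auto

lemma osc_least:
  assumes "finite V" "V \<noteq> {}" "\<And>x y. x \<in> V \<Longrightarrow> y \<in> V \<Longrightarrow> \<bar>f x - f y\<bar> \<le> c"
  shows "osc V f \<le> c"
  unfolding osc_def using assms by (subst Max_le_iff) auto

lemma osc_nonneg:
  assumes "finite V" "V \<noteq> {}"
  shows "0 \<le> osc V f"
  using assms osc_upper[of V _ _ f] by (metis abs_ge_zero equals0I order_trans)

lemma osc_cong:
  assumes "\<And>x. x \<in> V \<Longrightarrow> f x = g x"
  shows "osc V f = osc V g"
  unfolding osc_def using assms by (intro arg_cong[where f = Max] image_cong) auto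

lemma osc_affine:
  assumes "finite V" "V \<noteq> {}"
  shows "osc V (\<lambda>x. t * f x + s) = \<bar>t\<bar> * osc V f"
proof -
  have "osc V (\<lambda>x. t * f x + s) = Max ((\<lambda>d. \<bar>t\<bar> * d) ` ((\<lambda>(x, y). \<bar>f x - f y\<bar>) ` (V \<times> V)))"
    unfolding osc_def image_image
    by (intro arg_cong[where f = Max] image_cong)
       (auto simp: abs_mult[symmetric] right_diff_distrib)
  also have "\<dots> = \<bar>t\<bar> * osc V f"
    unfolding osc_def using assms
    by (intro mono_Max_commute[symmetric] monoI mult_left_mono) auto
  finally show ?thesis .
qed

text \<open>
  For positive a and b this is the convexity of the power; if one of them is 0, it reduces to
  \<open>t powr p \<le> t\<close>.
\<close>

lemma powr_convex_combination:
  fixes a b t :: real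
  assumes "1 < p" "0 \<le> a" "0 \<le> b" "0 < t" "t < 1"
  shows "(t * a + (1 - t) * b) powr p \<le> t * a powr p + (1 - t) * b powr p"
proof -
  have le: "s powr p \<le> s" if "0 < s" "s < 1" for s :: real
    using powr_mono'[of 1 p s] that assms(1) by simp
  consider "a = 0" | "b = 0" | "0 < a" "0 < b"
    using assms by linarith
  then show ?thesis
  proof cases
    case 1
    then show ?thesis using le[of "1 - t"] assms by (simp add: powr_mult mult_right_mono)
  next
    case 2
    then show ?thesis using le[of t] assms by (simp add: powr_mult mult_right_mono)
  next
    case 3
    then show ?thesis
      using convex_onD[OF powr_convex[of p], of t b a] assms by (simp add: algebra_simps)
  qed
qed

definition osc_energy :: "real \<Rightarrow> 'a set \<Rightarrow> ('a \<Rightarrow> real) \<Rightarrow> real" where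
  "osc_energy p V f = osc V f powr p"

lemma osc_energy_in_energies:
  assumes "1 < p" "finite V" "V \<noteq> {}"
  shows "osc_energy p V \<in> energies p V"
proof -
  note fin = assms(2,3)
  have nn: "0 \<le> osc V f" for f :: "'a \<Rightarrow> real"
    by (rule osc_nonneg[OF fin])
  have "osc_energy p V f = osc_energy p V g" if "\<forall>x\<in>V. f x = g x" for f g
    using osc_cong[of V f g] that by (simp add: osc_energy_def)
  moreover have "osc_energy p V (\<lambda>x. t * f x + (1 - t) * g x)
      \<le> t * osc_energy p V f + (1 - t) * osc_energy p V g" if t: "0 < t" "t < 1" for f g t
  proof -
    have "osc V (\<lambda>x. t * f x + (1 - t) * g x) \<le> t * osc V f + (1 - t) * osc V g"
    proof (rule osc_least[OF fin])
      fix x y assume xy: "x \<in> V" "y \<in> V"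
      have "\<bar>(t * f x + (1 - t) * g x) - (t * f y + (1 - t) * g y)\<bar>
          = \<bar>t * (f x - f y) + (1 - t) * (g x - g y)\<bar>"
        by (simp add: algebra_simps)
      also have "\<dots> \<le> t * \<bar>f x - f y\<bar> + (1 - t) * \<bar>g x - g y\<bar>"
        using t abs_triangle_ineq[of "t * (f x - f y)" "(1 - t) * (g x - g y)"]
        by (simp add: abs_mult)
      also have "\<dots> \<le> t * osc V f + (1 - t) * osc V g"
        using t osc_upper[OF fin(1) xy] by (intro add_mono mult_left_mono) auto
      finally show "\<bar>(t * f x + (1 - t) * g x) - (t * f y + (1 - t) * g y)\<bar> \<le> \<dots>" .
    qed
    then have "osc_energy p V (\<lambda>x. t * f x + (1 - t) * g x)
        \<le> (t * osc V f + (1 - t) * osc V g) powr p"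
      unfolding osc_energy_def using nn assms(1) by (intro powr_mono2) auto
    also have "\<dots> \<le> t * osc_energy p V f + (1 - t) * osc_energy p V g"
      unfolding osc_energy_def using powr_convex_combination[OF assms(1) nn nn t] .
    finally show ?thesis .
  qed
  moreover have "osc_energy p V (\<lambda>x. t * f x) = \<bar>t\<bar> powr p * osc_energy p V f" for f t
    using osc_affine[OF fin, of t f 0] nn[of f] by (simp add: osc_energy_def powr_mult)
  moreover have "osc_energy p V (\<lambda>x. f x + t) = osc_energy p V f" for f t
    using osc_affine[OF fin, of 1 f t] by (simp add: osc_energy_def)
  moreover have "osc_energy p V (\<lambda>x. min (max (f x) 0) 1) \<le> osc_energy p V f" for f
  proof -
    have "osc V (\<lambda>x. min (max (f x) 0) 1) \<le> osc V f"
    proof (rule osc_least[OF fin])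
      fix x y assume "x \<in> V" "y \<in> V"
      then show "\<bar>min (max (f x) 0) 1 - min (max (f y) 0) 1\<bar> \<le> osc V f"
        using osc_upper[OF fin(1), of x y f] by linarith
    qed
    then show ?thesis
      unfolding osc_energy_def using nn assms(1) by (intro powr_mono2) auto
  qed
  moreover have "osc_energy p V f = 0 \<longleftrightarrow> (\<exists>c. \<forall>x\<in>V. f x = c)" for f
  proof
    assume "osc_energy p V f = 0"
    then have 0: "osc V f = 0" by (simp add: osc_energy_def)
    obtain v where v: "v \<in> V" using fin by auto
    have "f x = f v" if "x \<in> V" for x
      using osc_upper[OF fin(1) that v, of f] 0 by simp
    then show "\<exists>c. \<forall>x\<in>V. f x = c" by blast
  next
    assume "\<exists>c. \<forall>x\<in>V. f x = c"
    then have "osc V f \<le> 0" by (intro osc_least[OF fin]) auto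
    then show "osc_energy p V f = 0" using nn[of f] assms(1) by (simp add: osc_energy_def)
  qed
  moreover have "0 \<le> osc_energy p V f" for f
    by (simp add: osc_energy_def)
  ultimately show ?thesis
    unfolding energies_def by blast
qed


section \<open>Traces\<close>

lemma trace_le:
  assumes "\<And>f. 0 \<le> U f" "\<And>x. x \<in> B \<Longrightarrow> f' x = f x"
  shows "energy_trace B U f \<le> U f'"
  unfolding energy_trace_def
  by (rule cInf_lower) (use assms in \<open>auto intro!: bdd_belowI[of _ 0]\<close>)

lemma trace_greatest:
  assumes "\<And>f'. (\<And>x. x \<in> B \<Longrightarrow> f' x = f x) \<Longrightarrow> c \<le> U f'"
  shows "c \<le> energy_trace B U f"
  unfolding energy_trace_def
  by (rule cInf_greatest) (use assms in auto)

text \<open>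
  Minimizing extensions need not be known to exist; energies of traces are therefore compared by
  transforming every extension of f into one of g.
\<close>

lemma trace_le_mult_trace:
  assumes U: "\<And>f. 0 \<le> U f" and c: "0 \<le> c"
    and ex: "\<And>f'. (\<And>x. x \<in> B \<Longrightarrow> f' x = f x) \<Longrightarrow>
      \<exists>g'. (\<forall>x\<in>B. g' x = g x) \<and> U g' \<le> c * U f'"
  shows "energy_trace B U g \<le> c * energy_trace B U f"
proof -
  have le: "energy_trace B U g \<le> c * U f'" if f': "\<And>x. x \<in> B \<Longrightarrow> f' x = f x" for f'
  proof -
    obtain g' where "\<forall>x\<in>B. g' x = g x" "U g' \<le> c * U f'"
      using ex[OF f'] by blast
    then show ?thesis
      using trace_le[of U B g' g] U by force
  qed
  show ?thesis
  proof (cases "c = 0")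
    case True
    then show ?thesis using le[of f] by simp
  next
    case False
    then have "energy_trace B U g / c \<le> energy_trace B U f"
      using le c by (intro trace_greatest) (simp add: field_simps)
    then show ?thesis using False c by (simp add: field_simps)
  qed
qed

lemma add_trace_le_mult_add_trace:
  assumes U: "\<And>f. 0 \<le> U f" and c: "0 < c"
    and ex: "\<And>a' b'. (\<And>x. x \<in> B \<Longrightarrow> a' x = a x) \<Longrightarrow> (\<And>x. x \<in> B \<Longrightarrow> b' x = b x) \<Longrightarrow>
      \<exists>g' h'. (\<forall>x\<in>B. g' x = g x) \<and> (\<forall>x\<in>B. h' x = h x) \<and> U g' + U h' \<le> c * (U a' + U b')"
  shows "energy_trace B U g + energy_trace B U h
    \<le> c * (energy_trace B U a + energy_trace B U b)"
proof -
  define X where "X = (energy_trace B U g + energy_trace B U h) / c"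
  have le: "X \<le> U a' + U b'"
    if ab: "\<And>x. x \<in> B \<Longrightarrow> a' x = a x" "\<And>x. x \<in> B \<Longrightarrow> b' x = b x" for a' b'
  proof -
    obtain g' h' where *: "\<forall>x\<in>B. g' x = g x" "\<forall>x\<in>B. h' x = h x"
        "U g' + U h' \<le> c * (U a' + U b')"
      using ex[OF ab] by blast
    then have "energy_trace B U g + energy_trace B U h \<le> c * (U a' + U b')"
      using trace_le[of U B g' g] trace_le[of U B h' h] U by force
    then show ?thesis using c by (simp add: X_def field_simps)
  qed
  have "X - U b' \<le> energy_trace B U a" if "\<And>x. x \<in> B \<Longrightarrow> b' x = b x" for b'
    using le that by (intro trace_greatest) (simp add: field_simps)
  then have "X - energy_trace B U a \<le> energy_trace B U b"
    by (intro trace_greatest) (simp add: field_simps)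
  then show ?thesis using c by (simp add: X_def field_simps)
qed


section \<open>Chains\<close>

text \<open>
  L bounds the lengths of shortest chains; it must not depend on f.
\<close>

lemma chain_bound:
  assumes "finite E"
    and "\<And>x y. x \<in> X \<Longrightarrow> y \<in> X \<Longrightarrow> (x, y) \<in> E\<^sup>*"
  shows "\<exists>L>0. \<forall>(f :: 'a \<Rightarrow> real) B. 0 \<le> B \<longrightarrow> (\<forall>(x, y)\<in>E. \<bar>f x - f y\<bar> \<le> B) \<longrightarrow>
    (\<forall>x\<in>X. \<forall>y\<in>X. \<bar>f x - f y\<bar> \<le> L * B)"
proof (intro exI conjI allI impI ballI)
  show "0 < real (card E) + 1" by simp
  fix f :: "'a \<Rightarrow> real" and B x y
  assume B: "0 \<le> B" and edges: "\<forall>(x, y)\<in>E. \<bar>f x - f y\<bar> \<le> B" and "x \<in> X" "y \<in> X"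
  then obtain n where n: "n \<le> card E" "(x, y) \<in> E ^^ n"
    using assms rtrancl_finite_eq_relpow[of E] by blast
  have "(x, y) \<in> E ^^ n \<Longrightarrow> \<bar>f x - f y\<bar> \<le> real n * B" for n y
  proof (induction n arbitrary: y)
    case (Suc n)
    then obtain z where "(x, z) \<in> E ^^ n" "(z, y) \<in> E" by auto
    then show ?case using Suc.IH[of z] edges by (fastforce simp: algebra_simps)
  qed simp
  then have "\<bar>f x - f y\<bar> \<le> real n * B" using n by blast
  also have "\<dots> \<le> (real (card E) + 1) * B" using n B by (intro mult_right_mono) auto
  finally show "\<bar>f x - f y\<bar> \<le> (real (card E) + 1) * B" .
qed


section \<open>Coding of post-critically finite sets\<close>

lemma similitude_inner:
  assumes "similitude f"
  obtains \<alpha> where "0 < \<alpha>" "\<alpha> < 1"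
    "\<And>x y u v. (f x - f y) \<bullet> (f u - f v) = \<alpha>\<^sup>2 * ((x - y) \<bullet> (u - v))"
proof -
  obtain \<alpha> U a where \<alpha>: "0 < \<alpha>" "\<alpha> < 1" and U: "orthogonal_transformation U"
    and f: "\<And>x. f x = \<alpha> *\<^sub>R U x + a"
    using assms unfolding similitude_def by blast
  interpret U: linear U
    using U by (rule orthogonal_transformation_linear)
  have "(f x - f y) \<bullet> (f u - f v) = \<alpha>\<^sup>2 * ((x - y) \<bullet> (u - v))" for x y u v
  proof -
    have "f x - f y = \<alpha> *\<^sub>R U (x - y)" "f u - f v = \<alpha> *\<^sub>R U (u - v)"
      by (simp_all add: f U.diff algebra_simps)
    then show ?thesis
      using U by (simp add: orthogonal_transformation_def power2_eq_square)
  qed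
  then show ?thesis using that \<alpha> by blast
qed

lemma similitude_dist:
  assumes "similitude f"
  obtains \<alpha> where "0 < \<alpha>" "\<alpha> < 1" "\<And>x y. dist (f x) (f y) = \<alpha> * dist x y"
proof -
  obtain \<alpha> where \<alpha>: "0 < \<alpha>" "\<alpha> < 1"
    "\<And>x y u v. (f x - f y) \<bullet> (f u - f v) = \<alpha>\<^sup>2 * ((x - y) \<bullet> (u - v))"
    using similitude_inner[OF assms] by blast
  have "dist (f x) (f y) = \<alpha> * dist x y" for x y
    using \<alpha>(1) by (simp add: dist_norm norm_eq_sqrt_inner \<alpha>(3) real_sqrt_mult)
  then show ?thesis using that \<alpha> by blast
qed

lemma similitude_inj: "similitude f \<Longrightarrow> inj f"
  by (rule injI) (metis dist_eq_0_iff less_irrefl mult_eq_0_iff similitude_dist)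

lemma similitude_continuous:
  assumes "similitude f"
  shows "continuous_on S f"
proof -
  obtain \<alpha> U a where U: "orthogonal_transformation U" and f: "\<And>x. f x = \<alpha> *\<^sub>R U x + a"
    using assms unfolding similitude_def by blast
  have "continuous_on S (\<lambda>x. \<alpha> *\<^sub>R U x + a)"
    using U by (intro continuous_intros linear_continuous_on)
       (simp add: linear_conv_bounded_linear[symmetric] orthogonal_transformation_linear)
  then show ?thesis using f by (simp cong: continuous_on_cong)
qed

lemma word_map_append: "word_map F (u @ v) = word_map F u \<circ> word_map F v"
  by (induction u) (auto simp: o_assoc)

declare vertices.simps [simp del]

locale pcf_fractal =
  fixes N :: nat and F :: "nat \<Rightarrow> 'a::euclidean_space \<Rightarrow> 'a" and K :: "'a set"
  assumes self_similar: "self_similar_set N F K" and pcf: "pcf N F K"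
begin

abbreviation V :: "'a set" where "V \<equiv> vertices N F K 0"

lemma two_le_N: "2 \<le> N"
  and similitude_F: "i \<in> {1..N} \<Longrightarrow> similitude (F i)"
  and K_nonempty: "K \<noteq> {}" and K_compact: "compact K" and K_connected: "connected K"
  and K_eq: "K = (\<Union>i\<in>{1..N}. F i ` K)"
  using self_similar unfolding self_similar_set_def by auto

lemma F_eq_iff: "i \<in> {1..N} \<Longrightarrow> F i x = F i y \<longleftrightarrow> x = y"
  using similitude_inj[OF similitude_F] by (auto dest: injD)

lemma F_in_K: "i \<in> {1..N} \<Longrightarrow> x \<in> K \<Longrightarrow> F i x \<in> K"
  by (rule K_eq[THEN equalityD2, THEN subsetD]) blast

lemma K_in_cell:
  assumes "x \<in> K"
  obtains i y where "i \<in> {1..N}" "y \<in> K" "x = F i y"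
proof -
  have "x \<in> (\<Union>i\<in>{1..N}. F i ` K)"
    using assms by (rule K_eq[THEN equalityD1, THEN subsetD])
  then show ?thesis using that by blast
qed

lemma compact_cell: "i \<in> {1..N} \<Longrightarrow> compact (F i ` K)"
  using K_compact similitude_continuous[OF similitude_F] by (intro compact_continuous_image)

lemma word_map_continuous: "set w \<subseteq> {1..N} \<Longrightarrow> continuous_on S (word_map F w)"
proof (induction w)
  case (Cons i w)
  then show ?case
    using continuous_on_compose[of S "word_map F w" "F i"] similitude_continuous[OF similitude_F]
    by simp
qed auto

lemma word_map_dist:
  obtains \<alpha> where "0 < \<alpha>" "\<alpha> < 1"
    "\<And>w x y. set w \<subseteq> {1..N} \<Longrightarrow> dist (word_map F w x) (word_map F w y) \<le> \<alpha> ^ length w * dist x y"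
proof -
  have "\<forall>i\<in>{1..N}. \<exists>\<alpha>. 0 < \<alpha> \<and> \<alpha> < 1 \<and> (\<forall>x y. dist (F i x) (F i y) = \<alpha> * dist x y)"
    using similitude_dist[OF similitude_F] by metis
  then obtain a where a: "\<And>i. i \<in> {1..N} \<Longrightarrow> 0 < a i \<and> a i < 1"
      "\<And>i x y. i \<in> {1..N} \<Longrightarrow> dist (F i x) (F i y) = a i * dist x y"
    by metis
  define \<alpha> where "\<alpha> = Max (a ` {1..N})"
  have ne: "a ` {1..N} \<noteq> {}" using two_le_N by auto
  have le: "a i \<le> \<alpha>" if "i \<in> {1..N}" for i
    unfolding \<alpha>_def using that by (intro Max_ge) auto
  have "\<alpha> < 1" unfolding \<alpha>_def using ne a(1) by (subst Max_less_iff) auto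
  have "0 < \<alpha>" using a(1)[of 1] le[of 1] two_le_N by force
  have "dist (word_map F w x) (word_map F w y) \<le> \<alpha> ^ length w * dist x y"
    if "set w \<subseteq> {1..N}" for w x y
    using that
  proof (induction w)
    case (Cons i w)
    then have i: "i \<in> {1..N}" by simp
    have "dist (word_map F (i # w) x) (word_map F (i # w) y)
        = a i * dist (word_map F w x) (word_map F w y)"
      using a(2)[OF i] by simp
    also have "\<dots> \<le> \<alpha> * (\<alpha> ^ length w * dist x y)"
      using Cons le[OF i] a(1)[OF i] by (intro mult_mono) auto
    finally show ?case by (simp add: mult.assoc)
  qed simp
  then show ?thesis using that \<open>0 < \<alpha>\<close> \<open>\<alpha> < 1\<close> by blast
qed

lemma code_prefix: "\<omega> \<in> code_space N \<Longrightarrow> set (map \<omega> [0..<n]) \<subseteq> {1..N}"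
  by (auto simp: code_space_def Pi_iff)

lemma coding_map_unique:
  assumes \<omega>: "\<omega> \<in> code_space N"
    and "\<And>n. x \<in> word_map F (map \<omega> [0..<n]) ` K" "\<And>n. y \<in> word_map F (map \<omega> [0..<n]) ` K"
  shows "x = y"
proof -
  obtain \<alpha> where \<alpha>: "0 < \<alpha>" "\<alpha> < 1"
    "\<And>w x y. set w \<subseteq> {1..N} \<Longrightarrow> dist (word_map F w x) (word_map F w y) \<le> \<alpha> ^ length w * dist x y"
    using word_map_dist by blast
  have "dist x y \<le> \<alpha> ^ n * diameter K" for n
  proof -
    obtain x' y' where *: "x' \<in> K" "y' \<in> K" "x = word_map F (map \<omega> [0..<n]) x'"
        "y = word_map F (map \<omega> [0..<n]) y'"
      using assms(2,3)[of n] by blast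
    have "dist x y \<le> \<alpha> ^ n * dist x' y'"
      using \<alpha>(3)[OF code_prefix[OF \<omega>], of n x' y'] * by simp
    also have "\<dots> \<le> \<alpha> ^ n * diameter K"
      using * K_compact \<alpha>(1)
      by (intro mult_left_mono diameter_bounded_bound compact_imp_bounded) auto
    finally show ?thesis .
  qed
  moreover have "(\<lambda>n. \<alpha> ^ n * diameter K) \<longlonglongrightarrow> 0 * diameter K"
    using \<alpha> by (intro tendsto_mult LIMSEQ_power_zero tendsto_const) auto
  ultimately have "dist x y \<le> 0"
    by (intro LIMSEQ_le_const[where X = "\<lambda>n. \<alpha> ^ n * diameter K"]) auto
  then show ?thesis by simp
qed

lemma coding_map_eqI:
  assumes "\<omega> \<in> code_space N" "\<And>n. x \<in> word_map F (map \<omega> [0..<n]) ` K"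
  shows "coding_map F K \<omega> = x"
  unfolding coding_map_def
proof -
  have "(\<Inter>n. word_map F (map \<omega> [0..<n]) ` K) = {x}"
  proof (intro equalityI subsetI)
    fix y assume "y \<in> (\<Inter>n. word_map F (map \<omega> [0..<n]) ` K)"
    then have "y = x"
      by (intro coding_map_unique[OF assms(1) _ assms(2)]) (rule INT_D, auto)
    then show "y \<in> {x}" by simp
  qed (use assms(2) in simp)
  then show "(THE x. (\<Inter>n. word_map F (map \<omega> [0..<n]) ` K) = {x}) = x" by simp
qed

lemma coding_map_in_cell:
  assumes \<omega>: "\<omega> \<in> code_space N"
  shows "coding_map F K \<omega> \<in> word_map F (map \<omega> [0..<n]) ` K"
proof -
  let ?A = "\<lambda>n. word_map F (map \<omega> [0..<n]) ` K"
  have "\<Inter> (range ?A) \<noteq> {}"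
  proof (rule compact_nest)
    show "compact (?A n)" for n
      using word_map_continuous[OF code_prefix[OF \<omega>]] K_compact
      by (intro compact_continuous_image)
    show "?A n \<noteq> {}" for n using K_nonempty by simp
    have "?A (Suc n) \<subseteq> ?A n" for n
    proof -
      have "\<omega> n \<in> {1..N}" using \<omega> by (auto simp: code_space_def)
      then have "F (\<omega> n) x \<in> K" if "x \<in> K" for x using F_in_K that by blast
      then show ?thesis by (auto simp: word_map_append)
    qed
    then show "m \<le> n \<Longrightarrow> ?A n \<subseteq> ?A m" for m n by (rule lift_Suc_antimono_le)
  qed
  then obtain x where x: "\<And>n. x \<in> ?A n" by blast
  then have "coding_map F K \<omega> = x" by (rule coding_map_eqI[OF \<omega>])
  then show ?thesis using x by simp
qed

lemma coding_map_in_K: "\<omega> \<in> code_space N \<Longrightarrow> coding_map F K \<omega> \<in> K"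
  using coding_map_in_cell[of \<omega> 0] by simp

lemma left_shift_code_space: "\<omega> \<in> code_space N \<Longrightarrow> left_shift \<omega> \<in> code_space N"
  by (auto simp: code_space_def left_shift_def)

lemma coding_map_left_shift:
  assumes \<omega>: "\<omega> \<in> code_space N"
  shows "coding_map F K \<omega> = F (\<omega> 0) (coding_map F K (left_shift \<omega>))"
proof (rule coding_map_eqI[OF \<omega>])
  have \<omega>0: "\<omega> 0 \<in> {1..N}" using \<omega> by (auto simp: code_space_def)
  show "F (\<omega> 0) (coding_map F K (left_shift \<omega>)) \<in> word_map F (map \<omega> [0..<n]) ` K" for n
  proof (cases n)
    case 0
    then show ?thesis
      using F_in_K[OF \<omega>0] coding_map_in_K[OF left_shift_code_space[OF \<omega>]] by simp
  next
    case (Suc m)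
    have "map \<omega> [0..<Suc m] = \<omega> 0 # map (left_shift \<omega>) [0..<m]"
      by (simp add: upt_conv_Cons map_Suc_upt[symmetric] left_shift_def del: upt_Suc)
    then show ?thesis
      using coding_map_in_cell[OF left_shift_code_space[OF \<omega>], of m] Suc by auto
  qed
qed

lemma coding_map_surj:
  assumes "x \<in> K"
  obtains \<omega> where "\<omega> \<in> code_space N" "coding_map F K \<omega> = x"
proof -
  have "\<forall>x\<in>K. \<exists>i y. i \<in> {1..N} \<and> y \<in> K \<and> x = F i y"
    using K_in_cell by metis
  then obtain i y where iy: "\<And>x. x \<in> K \<Longrightarrow> i x \<in> {1..N} \<and> y x \<in> K \<and> x = F (i x) (y x)"
    by metis
  define \<omega> where "\<omega> n = i ((y ^^ n) x)" for n
  have K: "(y ^^ n) x \<in> K" for n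
    by (induction n) (use assms iy in auto)
  have \<omega>: "\<omega> \<in> code_space N"
    using K iy by (auto simp: code_space_def \<omega>_def Pi_iff)
  have "x = word_map F (map \<omega> [0..<n]) ((y ^^ n) x)" for n
  proof (induction n)
    case (Suc n)
    have "(y ^^ n) x = F (\<omega> n) ((y ^^ Suc n) x)"
      using iy[OF K[of n]] by (simp add: \<omega>_def)
    then show ?case using Suc by (simp add: word_map_append)
  qed simp
  then show ?thesis
    using that \<omega> coding_map_eqI[OF \<omega>] K by (metis imageI)
qed

lemma postcritical_set_code_space: "postcritical_set N F K \<subseteq> code_space N"
proof -
  have "(left_shift ^^ m) \<omega> \<in> code_space N" if "\<omega> \<in> code_space N" for m \<omega>
    using that by (induction m) (auto intro: left_shift_code_space)
  then show ?thesis
    unfolding postcritical_set_def critical_set_def by blast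
qed

lemma left_shift_postcritical:
  assumes "\<omega> \<in> postcritical_set N F K"
  shows "left_shift \<omega> \<in> postcritical_set N F K"
proof -
  obtain m \<omega>' where "1 \<le> m" "\<omega>' \<in> critical_set N F K" "\<omega> = (left_shift ^^ m) \<omega>'"
    using assms unfolding postcritical_set_def by auto
  then show ?thesis
    unfolding postcritical_set_def
    by (intro UN_I[of "Suc m"]) auto
qed

lemma V_subset_K: "V \<subseteq> K"
  using postcritical_set_code_space coding_map_in_K by (auto simp: vertices.simps)

lemma V_finite: "finite V"
  using pcf by (simp add: pcf_def vertices.simps)

text \<open>
  If \<open>F i x\<close> lies in another cell and \<open>\<omega>\<close> is a code of x, then \<open>i \<omega>\<close> is critical,
  and its shift is \<open>\<omega>\<close>.
\<close>

lemma cell_intersection: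
  assumes ij: "i \<in> {1..N}" "j \<in> {1..N}" "i \<noteq> j"
    and x: "x \<in> K" and mem: "F i x \<in> F j ` K"
  shows "x \<in> V"
proof -
  obtain \<omega> where \<omega>: "\<omega> \<in> code_space N" "coding_map F K \<omega> = x"
    using coding_map_surj[OF x] .
  define \<omega>' where "\<omega>' = case_nat i \<omega>"
  have shift: "left_shift \<omega>' = \<omega>" by (auto simp: left_shift_def \<omega>'_def)
  have \<omega>': "\<omega>' \<in> code_space N"
    using \<omega>(1) ij(1) by (auto simp: code_space_def \<omega>'_def Pi_iff split: nat.split)
  then have "coding_map F K \<omega>' = F i x"
    using coding_map_left_shift[OF \<omega>'] \<omega>(2) by (simp add: shift) (simp add: \<omega>'_def)
  then have "coding_map F K \<omega>' \<in> F i ` K \<inter> F j ` K"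
    using x mem by simp
  then have "\<omega>' \<in> critical_set N F K"
    unfolding critical_set_def using \<omega>' ij by blast
  then have "(left_shift ^^ 1) \<omega>' \<in> postcritical_set N F K"
    unfolding postcritical_set_def by blast
  then show ?thesis using shift \<omega>(2) by (auto simp: vertices.simps)
qed

text \<open>
  The boundary is contained in the set of vertices of the first level, because the post-critical
  set is invariant under the shift.
\<close>

lemma V_in_cell:
  assumes "x \<in> V"
  obtains i v where "i \<in> {1..N}" "v \<in> V" "x = F i v"
proof -
  obtain \<omega> where \<omega>: "\<omega> \<in> postcritical_set N F K" "x = coding_map F K \<omega>"
    using assms by (auto simp: vertices.simps)
  then have cs: "\<omega> \<in> code_space N" using postcritical_set_code_space by blast
  show ?thesis
  proof (rule that)
    show "\<omega> 0 \<in> {1..N}" using cs by (auto simp: code_space_def)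
    show "coding_map F K (left_shift \<omega>) \<in> V" 
      using left_shift_postcritical[OF \<omega>(1)] by (simp add: vertices.simps)
    show "x = F (\<omega> 0) (coding_map F K (left_shift \<omega>))"
      using coding_map_left_shift[OF cs] \<omega>(2) by simp
  qed
qed

text \<open>
  A boundary point that lies in a cell is also the image of a boundary point under the map of
  some cell; if this is another cell, the two cells meet there.
\<close>

lemma V_inter_cell:
  assumes "i \<in> {1..N}" "x \<in> K" "F i x \<in> V"
  shows "x \<in> V"
proof -
  obtain j v where j: "j \<in> {1..N}" "v \<in> V" "F i x = F j v"
    using V_in_cell[OF assms(3)] .
  show ?thesis
  proof (cases "i = j")
    case True
    then show ?thesis using j F_eq_iff assms(1) by metis
  next
    case False
    then show ?thesis
      using cell_intersection[OF assms(1) j(1) _ assms(2)] j V_subset_K by blast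
  qed
qed

text \<open>
  As K is connected, the closed sets formed by two complementary families of cells meet; by
  the previous lemmas they do so in images of boundary points.
\<close>

lemma cells_linked:
  assumes "I \<subseteq> {1..N}" "I \<noteq> {}" "I \<noteq> {1..N}"
  obtains i j x y where "i \<in> I" "j \<in> {1..N} - I" "x \<in> V" "y \<in> V" "F i x = F j y"
proof -
  let ?A = "\<Union>i\<in>I. F i ` K" and ?B = "\<Union>j\<in>{1..N} - I. F j ` K"
  have "finite I" using assms(1) finite_subset by blast
  then have "closed ?A" "closed ?B"
    using assms(1) compact_cell
    by (auto intro!: closed_UN compact_imp_closed simp del: compact_UN atLeastAtMost_iff)
  moreover have "K \<subseteq> ?A \<union> ?B"
  proof
    fix x assume "x \<in> K"
    then obtain i y where "i \<in> {1..N}" "y \<in> K" "x = F i y" by (rule K_in_cell)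
    then show "x \<in> ?A \<union> ?B" by (cases "i \<in> I") auto
  qed
  moreover have "(\<Union>i\<in>J. F i ` K) \<inter> K \<noteq> {}" if J: "J \<subseteq> {1..N}" "J \<noteq> {}" for J
  proof -
    obtain i k where "i \<in> J" "k \<in> K" using J(2) K_nonempty by (meson ex_in_conv)
    then have "F i k \<in> (\<Union>i\<in>J. F i ` K) \<inter> K" using F_in_K[of i k] J(1) by auto
    then show ?thesis by (metis empty_iff)
  qed
  moreover have "{1..N} - I \<noteq> {}" using assms by auto
  ultimately have "?A \<inter> ?B \<inter> K \<noteq> {}"
    using K_connected assms(1,2) unfolding connected_closed by (metis Diff_subset)
  then obtain q where q: "q \<in> ?A" "q \<in> ?B" by auto
  obtain i x where i: "i \<in> I" "x \<in> K" "q = F i x" using q(1) by blast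
  obtain j y where j: "j \<in> {1..N} - I" "y \<in> K" "q = F j y" using q(2) by blast
  have *: "i \<in> I" "j \<in> {1..N} - I" "x \<in> K" "y \<in> K" "F i x = F j y" using i j by auto
  show ?thesis
  proof (rule that[OF *(1,2) _ _ *(5)])
    have ij: "i \<in> {1..N}" "j \<in> {1..N}" "i \<noteq> j" using * assms(1) by auto
    have "F i x \<in> F j ` K" "F j y \<in> F i ` K" using * by (metis imageI)+
    then show "x \<in> V" "y \<in> V"
      using cell_intersection[OF ij *(3)] cell_intersection[OF ij(2,1) _ *(4)] ij(3) by auto
  qed
qed

lemma V_nonempty: "V \<noteq> {}"
proof -
  have "{1} \<subseteq> {1..N}" "2 \<notin> {1 :: nat}" "2 \<in> {1..N}" using two_le_N by auto
  then obtain x where "x \<in> V" using cells_linked[of "{1}"] by (metis insert_not_empty)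
  then show ?thesis by blast
qed

text \<open>
  If x were the only boundary point, then linked cells would be linked at the image of x.
  Some cell map fixes x, since the post-critical set is shift invariant; hence all of them do,
  every code is a code of x, and the post-critical set is the whole infinite code space.
\<close>

lemma V_not_singleton: "V \<noteq> {x}"
proof
  assume V: "V = {x}"
  define I where "I = {i \<in> {1..N}. F i x = x}"
  have "I \<noteq> {}"
  proof -
    obtain i v where "i \<in> {1..N}" "v \<in> V" "x = F i v"
      using V_in_cell[of x] V by (auto)
    then show ?thesis using V by (auto simp: I_def)
  qed
  have "I = {1..N}"
  proof (rule ccontr)
    assume "I \<noteq> {1..N}"
    moreover have "I \<subseteq> {1..N}" by (auto simp: I_def)
    ultimately obtain i j u v where
      "i \<in> I" "j \<in> {1..N} - I" "u \<in> V" "v \<in> V" "F i u = F j v"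
      using cells_linked[of I] \<open>I \<noteq> {}\<close> by metis
    then show False using V by (auto simp: I_def)
  qed
  then have fix_x: "word_map F w x = x" if "set w \<subseteq> {1..N}" for w
    using that by (induction w) (auto simp: I_def)
  have "x \<in> K" using V V_subset_K by blast
  have code: "coding_map F K \<omega> = x" if "\<omega> \<in> code_space N" for \<omega>
    using coding_map_eqI[OF that] fix_x[OF code_prefix[OF that]] \<open>x \<in> K\<close> by (metis imageI)
  have "code_space N \<subseteq> postcritical_set N F K"
  proof
    fix \<omega> assume \<omega>: "\<omega> \<in> code_space N"
    define \<omega>' where "\<omega>' = case_nat 1 \<omega>"
    have "\<omega>' \<in> code_space N"
      using \<omega> two_le_N by (auto simp: code_space_def \<omega>'_def Pi_iff split: nat.split)
    moreover have "\<exists>i\<in>{1..N}. \<exists>j\<in>{1..N}. i \<noteq> j \<and> x \<in> F i ` K \<inter> F j ` K"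
    proof (intro bexI conjI)
      show "x \<in> F 1 ` K \<inter> F 2 ` K"
        using fix_x[of "[1]"] fix_x[of "[2]"] \<open>x \<in> K\<close> two_le_N by (force simp: image_iff)
    qed (use two_le_N in auto)
    ultimately have "\<omega>' \<in> critical_set N F K"
      unfolding critical_set_def using code by auto
    moreover have "left_shift \<omega>' = \<omega>" by (auto simp: left_shift_def \<omega>'_def)
    ultimately show "\<omega> \<in> postcritical_set N F K"
      unfolding postcritical_set_def by (intro UN_I[of 1]) auto
  qed
  then have fin: "finite (code_space N)"
    using pcf finite_subset unfolding pcf_def by blast
  have "range (\<lambda>(A :: nat set) n. if n \<in> A then 1 else 2 :: nat) \<subseteq> code_space N"
    using two_le_N by (auto simp: code_space_def)
  then have "finite (range (\<lambda>(A :: nat set) n. if n \<in> A then 1 else 2 :: nat))"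
    using fin finite_subset by blast
  moreover have "inj (\<lambda>(A :: nat set) n. if n \<in> A then 1 else 2 :: nat)"
    by (rule injI) (auto simp: fun_eq_iff split: if_splits)
  ultimately have "finite (UNIV :: nat set set)"
    using finite_imageD by blast
  then show False by (simp add: Finite_Set.finite_set)
qed

lemma V_other_point: "\<exists>y\<in>V. y \<noteq> x"
  using V_nonempty V_not_singleton[of x] by (metis subset_singletonD subsetI singletonI)

text \<open>The cells that can be reached from x form a family that is not linked to its complement.\<close>

lemma V1_connected:
  assumes "x \<in> (\<Union>i\<in>{1..N}. F i ` V)" "y \<in> (\<Union>i\<in>{1..N}. F i ` V)"
  shows "(x, y) \<in> (\<Union>i\<in>{1..N}. (F i ` V) \<times> (F i ` V))\<^sup>*" (is "_ \<in> ?E\<^sup>*")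
proof -
  define I where "I = {i \<in> {1..N}. \<forall>z\<in>F i ` V. (x, z) \<in> ?E\<^sup>*}"
  have extend: "i \<in> I" if "i \<in> {1..N}" "z \<in> F i ` V" "(x, z) \<in> ?E\<^sup>*" for i z
  proof -
    have "(x, z') \<in> ?E\<^sup>*" if "z' \<in> F i ` V" for z'
      using \<open>z \<in> F i ` V\<close> \<open>i \<in> {1..N}\<close> that by (intro rtrancl_into_rtrancl[OF \<open>(x, z) \<in> ?E\<^sup>*\<close>]) blast
    then show ?thesis using that(1) by (simp add: I_def del: vertices.simps)
  qed
  have "I \<noteq> {}" using assms(1) extend by blast
  have "I = {1..N}"
  proof (rule ccontr)
    assume "I \<noteq> {1..N}"
    moreover have "I \<subseteq> {1..N}" by (auto simp: I_def)
    ultimately obtain i j u v where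
      ij: "i \<in> I" "j \<in> {1..N} - I" "u \<in> V" "v \<in> V" "F i u = F j v"
      using cells_linked[of I] \<open>I \<noteq> {}\<close> by metis
    then have "(x, F j v) \<in> ?E\<^sup>*" unfolding I_def by (metis (lifting) CollectD imageI)
    then show False using extend[of j "F j v"] ij by blast
  qed
  then show ?thesis using assms(2) by (auto simp: I_def)
qed

end


section \<open>Reflections\<close>

text \<open>
  Half the difference of the squared distances of x to z and to y: it vanishes on the bisecting
  hyperplane and is positive on the side of y.
\<close>

definition side :: "'a::euclidean_space \<Rightarrow> 'a \<Rightarrow> 'a \<Rightarrow> real" where
  "side y z x = (x - midpoint y z) \<bullet> (y - z)"

lemma bisector_reflection_side:
  "bisector_reflection y z x = x - (2 * side y z x / ((y - z) \<bullet> (y - z))) *\<^sub>R (y - z)"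
  by (simp add: bisector_reflection_def side_def)

lemma dist_side: "(dist x z)\<^sup>2 - (dist x y)\<^sup>2 = 2 * side y z x"
  by (simp add: side_def dist_norm power2_norm_eq_inner midpoint_def algebra_simps inner_commute)

lemma side_pos_iff: "0 < side y z x \<longleftrightarrow> dist x y < dist x z"
proof -
  have "dist x y < dist x z \<longleftrightarrow> (dist x y)\<^sup>2 < (dist x z)\<^sup>2"
    by (metis abs_of_nonneg abs_square_less_1 power2_less_imp_less power_strict_mono
        zero_le_dist zero_less_numeral)
  then show ?thesis using dist_side[of x z y] by linarith
qed

lemma side_bisector_reflection:
  assumes "y \<noteq> z"
  shows "side y z (bisector_reflection y z x) = - side y z x"
proof -
  have "side y z (x - c *\<^sub>R (y - z)) = side y z x - c * ((y - z) \<bullet> (y - z))" for c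
    by (simp add: side_def inner_diff_left)
  then show ?thesis using assms by (simp add: bisector_reflection_side)
qed

lemma bisector_reflection_involution:
  assumes "y \<noteq> z"
  shows "bisector_reflection y z (bisector_reflection y z x) = x"
proof -
  have "bisector_reflection y z (bisector_reflection y z x)
      = bisector_reflection y z x + (2 * side y z x / ((y - z) \<bullet> (y - z))) *\<^sub>R (y - z)"
    by (subst (1) bisector_reflection_side) (simp add: side_bisector_reflection[OF assms])
  then show ?thesis by (simp add: bisector_reflection_side)
qed

lemma bisector_reflection_eq_iff:
  assumes "y \<noteq> z"
  shows "bisector_reflection y z x = x \<longleftrightarrow> side y z x = 0"
  using assms by (simp add: bisector_reflection_side)

lemma dist_bisector_reflection:
  assumes "y \<noteq> z"
  shows "dist (bisector_reflection y z u) (bisector_reflection y z v) = dist u v"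
proof -
  define n where "n = y - z"
  define c where "c x = 2 * side y z x / (n \<bullet> n)" for x
  have "n \<noteq> 0" using assms by (simp add: n_def)
  have cd: "c u - c v = 2 * ((u - v) \<bullet> n) / (n \<bullet> n)"
    by (simp add: c_def side_def n_def[symmetric] diff_divide_distrib[symmetric] algebra_simps)
  have "bisector_reflection y z u - bisector_reflection y z v = (u - v) - (c u - c v) *\<^sub>R n"
    by (simp add: bisector_reflection_side c_def n_def algebra_simps)
  then have "(dist (bisector_reflection y z u) (bisector_reflection y z v))\<^sup>2
      = (norm ((u - v) - (c u - c v) *\<^sub>R n))\<^sup>2"
    by (simp add: dist_norm)
  also have "\<dots> = (u - v) \<bullet> (u - v) - 2 * (c u - c v) * ((u - v) \<bullet> n)
      + (c u - c v) * ((c u - c v) * (n \<bullet> n))"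
    by (simp add: power2_norm_eq_inner inner_diff_left inner_diff_right inner_commute algebra_simps)
  also have "(c u - c v) * (n \<bullet> n) = 2 * ((u - v) \<bullet> n)"
    using \<open>n \<noteq> 0\<close> by (simp add: cd)
  finally have "(dist (bisector_reflection y z u) (bisector_reflection y z v))\<^sup>2 = (dist u v)\<^sup>2"
    by (simp add: dist_norm power2_norm_eq_inner)
  then show ?thesis by simp
qed

text \<open>A reflection is the one attached to any pair of distinct points that it exchanges.\<close>

lemma bisector_reflection_of_image:
  assumes yz: "y \<noteq> z" and u: "u = bisector_reflection y z v" "0 < side y z v"
  shows "bisector_reflection v u = bisector_reflection y z"
    and "0 < side v u x \<longleftrightarrow> 0 < side y z x"
proof -
  define n where "n = y - z"
  define c where "c = side y z v / (n \<bullet> n)"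
  \<comment> \<open>The point v lies at \<open>c *\<^sub>R n\<close> from the hyperplane.\<close>
  have nn: "0 < n \<bullet> n" using yz by (simp add: n_def)
  have "c > 0" using u(2) nn by (simp add: c_def)
  have diff: "v - u = (2 * c) *\<^sub>R n"
    by (simp add: u(1) bisector_reflection_side n_def c_def)
  have mid: "midpoint v u = v - c *\<^sub>R n"
  proof -
    have "midpoint v u = v - (1/2) *\<^sub>R (v - u)"
      by (simp add: midpoint_def algebra_simps flip: scaleR_left.add)
    then show ?thesis by (simp add: diff)
  qed
  have side: "side v u x = 2 * c * side y z x" for x
  proof -
    have "side v u x = 2 * c * ((x - v) \<bullet> n + c * (n \<bullet> n))"
      by (simp add: side_def diff mid inner_diff_left inner_add_left algebra_simps)
    also have "c * (n \<bullet> n) = side y z v" using nn by (simp add: c_def)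
    also have "(x - v) \<bullet> n + side y z v = side y z x"
      by (simp add: side_def n_def[symmetric] algebra_simps)
    finally show ?thesis .
  qed
  show "0 < side v u x \<longleftrightarrow> 0 < side y z x"
    using \<open>c > 0\<close> by (simp add: side zero_less_mult_iff)
  show "bisector_reflection v u = bisector_reflection y z"
  proof
    fix x
    have "(2 * side v u x / ((v - u) \<bullet> (v - u))) *\<^sub>R (v - u)
        = (2 * side y z x / (n \<bullet> n)) *\<^sub>R n"
      using \<open>c > 0\<close> by (simp add: side diff)
    then show "bisector_reflection v u x = bisector_reflection y z x"
      by (simp add: bisector_reflection_side n_def)
  qed
qed

lemma similitude_midpoint:
  assumes "similitude f"
  shows "midpoint (f x) (f y) = f (midpoint x y)"
proof -
  obtain \<alpha> U a where U: "orthogonal_transformation U" and f: "\<And>x. f x = \<alpha> *\<^sub>R U x + a"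
    using assms unfolding similitude_def by blast
  interpret U: linear U
    using U by (rule orthogonal_transformation_linear)
  have half: "(1/2) *\<^sub>R a + (1/2) *\<^sub>R a = a"
  proof -
    have "(1/2) *\<^sub>R a + (1/2) *\<^sub>R a = ((1/2) + (1/2) :: real) *\<^sub>R a"
      by (rule scaleR_left_distrib[symmetric])
    also have "((1/2) + (1/2) :: real) = 1" by simp
    finally show ?thesis by (simp only: scaleR_one)
  qed
  have "midpoint (f x) (f y)
      = \<alpha> *\<^sub>R ((1/2) *\<^sub>R U x + (1/2) *\<^sub>R U y) + ((1/2) *\<^sub>R a + (1/2) *\<^sub>R a)"
    by (simp add: f midpoint_def scaleR_right_distrib mult.commute add.assoc add.left_commute)
  then show ?thesis
    by (simp add: half f midpoint_def U.add U.scale scaleR_right_distrib)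
qed

lemma similitude_side_pos_iff:
  assumes "similitude f"
  shows "0 < side (f y) (f z) (f x) \<longleftrightarrow> 0 < side y z x"
proof -
  obtain \<alpha> where "0 < \<alpha>" "\<alpha> < 1"
    "\<And>x y u v. (f x - f y) \<bullet> (f u - f v) = \<alpha>\<^sup>2 * ((x - y) \<bullet> (u - v))"
    using similitude_inner[OF assms] by blast
  then show ?thesis
    by (simp add: side_def similitude_midpoint[OF assms] zero_less_mult_iff)
qed

lemma similitude_bisector_reflection:
  assumes "similitude f"
  shows "bisector_reflection (f y) (f z) (f x) = f (bisector_reflection y z x)"
proof -
  obtain \<alpha> U a where \<alpha>: "0 < \<alpha>" and U: "orthogonal_transformation U"
    and f: "\<And>x. f x = \<alpha> *\<^sub>R U x + a"
    using assms unfolding similitude_def by blast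
  interpret U: linear U
    using U by (rule orthogonal_transformation_linear)
  have d: "f u - f v = \<alpha> *\<^sub>R U (u - v)" for u v
    by (simp add: f U.diff algebra_simps)
  have in_U: "U u \<bullet> U v = u \<bullet> v" for u v
    using U by (simp add: orthogonal_transformation_def)
  have "bisector_reflection (f y) (f z) (f x)
      = f x - (2 * side y z x / ((y - z) \<bullet> (y - z))) *\<^sub>R (\<alpha> *\<^sub>R U (y - z))"
    using \<alpha> by (simp add: bisector_reflection_side side_def similitude_midpoint[OF assms] d in_U)
  also have "\<dots> = f (bisector_reflection y z x)"
    by (simp add: f bisector_reflection_side U.diff U.scale scaleR_right_diff_distrib mult.commute)
  finally show ?thesis .
qed

text \<open>
  Isometries of a finite set V that is symmetric under the reflections between its points are
  products of such reflections: if v is moved to w, composition with the reflection exchanging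
  v and w fixes v and all points fixed before, as these are equidistant from v and w.
\<close>

lemma invariant_under_isometries:
  fixes V :: "'a::euclidean_space set" and E :: "('a \<Rightarrow> real) \<Rightarrow> real"
  assumes "finite V"
    and cong: "\<And>f g. (\<And>x. x \<in> V \<Longrightarrow> f x = g x) \<Longrightarrow> E f = E g"
    and refl_V: "\<And>y z x. y \<in> V \<Longrightarrow> z \<in> V \<Longrightarrow> y \<noteq> z \<Longrightarrow> x \<in> V \<Longrightarrow> bisector_reflection y z x \<in> V"
    and refl: "\<And>y z f. y \<in> V \<Longrightarrow> z \<in> V \<Longrightarrow> y \<noteq> z \<Longrightarrow> E (f \<circ> bisector_reflection y z) = E f"
    and "\<And>x. x \<in> V \<Longrightarrow> g x \<in> V"
    and "\<And>x y. x \<in> V \<Longrightarrow> y \<in> V \<Longrightarrow> dist (g x) (g y) = dist x y"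
  shows "E (f \<circ> g) = E f"
  using assms(5,6)
proof (induction "card {x \<in> V. g x \<noteq> x}" arbitrary: f g rule: less_induct)
  case less
  show ?case
  proof (cases "\<forall>x\<in>V. g x = x")
    case True
    then show ?thesis by (intro cong) simp
  next
    case False
    then obtain v where v: "v \<in> V" "g v \<noteq> v" by blast
    define \<rho> where "\<rho> = bisector_reflection (g v) v"
    have gv: "g v \<in> V" using less.prems(1) v(1) .
    have \<rho>: "\<rho> x \<in> V" if "x \<in> V" for x
      unfolding \<rho>_def using refl_V gv v that by blast
    have fixed: "(\<rho> \<circ> g) x = x" if x: "x \<in> V" "g x = x \<or> x = v" for x
    proof (cases "x = v")
      case True
      then show ?thesis using bisector_reflection_swap[OF v(2)] by (simp add: \<rho>_def)
    next
      case False
      then have "dist (g v) x = dist v x" using less.prems(2)[OF v(1) x(1)] x(2) by simp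
      then have "\<rho> x = x"
        unfolding \<rho>_def by (subst bisector_reflection_fixed_iff[OF v(2)])
      then show ?thesis using False x(2) by simp
    qed
    have "{x \<in> V. (\<rho> \<circ> g) x \<noteq> x} \<subset> {x \<in> V. g x \<noteq> x}"
      using v fixed by (intro psubsetI subsetI) (blast, metis (mono_tags, lifting) CollectD CollectI)
    then have "card {x \<in> V. (\<rho> \<circ> g) x \<noteq> x} < card {x \<in> V. g x \<noteq> x}"
      using assms(1) by (intro psubset_card_mono) auto
    then have "E ((f \<circ> \<rho>) \<circ> (\<rho> \<circ> g)) = E (f \<circ> \<rho>)"
    proof (rule less.hyps)
      show "(\<rho> \<circ> g) x \<in> V" if "x \<in> V" for x using \<rho> less.prems(1)[OF that] by simp
      show "dist ((\<rho> \<circ> g) x) ((\<rho> \<circ> g) y) = dist x y" if "x \<in> V" "y \<in> V" for x y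
        using less.prems(2)[OF that] dist_bisector_reflection[OF v(2)] by (simp add: \<rho>_def)
    qed
    moreover have "(f \<circ> \<rho>) \<circ> (\<rho> \<circ> g) = f \<circ> g"
      using bisector_reflection_involution[OF v(2)] by (auto simp: fun_eq_iff \<rho>_def)
    moreover have "E (f \<circ> \<rho>) = E f" unfolding \<rho>_def using refl[OF gv v(1,2)] .
    ultimately show ?thesis by simp
  qed
qed

lemma scaling_of_finite_set:
  fixes V :: "'a::metric_space set"
  assumes V: "finite V" "a \<in> V" "b \<in> V" "a \<noteq> b"
    and g: "g ` V = V" "\<And>x y. x \<in> V \<Longrightarrow> y \<in> V \<Longrightarrow> dist (g x) (g y) = t * dist x y"
  shows "t = 1"
proof -
  define D where "D = Max ((\<lambda>(x, y). dist x y) ` (V \<times> V))"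
  have le: "dist x y \<le> D" if "x \<in> V" "y \<in> V" for x y
    unfolding D_def using V(1) that by (intro Max_ge) auto
  have "D \<in> (\<lambda>(x, y). dist x y) ` (V \<times> V)"
    unfolding D_def using V by (intro Max_in) auto
  then obtain x y where xy: "x \<in> V" "y \<in> V" "D = dist x y" by auto
  have "0 < dist a b" using V(4) by simp
  then have "0 < D" using le[OF V(2,3)] by linarith
  have "t * D \<le> D"
    using g(2)[OF xy(1,2)] le[of "g x" "g y"] xy g(1) by (metis imageI)
  then have "t \<le> 1" using \<open>0 < D\<close> by simp
  obtain x' y' where xy': "x' \<in> V" "y' \<in> V" "x = g x'" "y = g y'"
    using xy g(1) by (metis imageE)
  then have D: "D = t * dist x' y'" using g(2) xy(3) by simp
  have "0 < t" using \<open>0 < D\<close> D by (metis not_less zero_le_dist mult_nonpos_nonneg)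
  then have "D \<le> t * D" using D le[OF xy'(1,2)] by (metis mult_le_cancel_left_pos)
  then show ?thesis using \<open>0 < D\<close> \<open>t \<le> 1\<close> by simp
qed


section \<open>Mixing two functions\<close>

text \<open>
  Across the zero set of l, the mixture exchanges the values of a and b so as to put the larger
  ones where l is positive. On the zero set itself a and b agree in all applications.
\<close>

definition mix :: "('a \<Rightarrow> real) \<Rightarrow> ('a \<Rightarrow> real) \<Rightarrow> ('a \<Rightarrow> real) \<Rightarrow> 'a \<Rightarrow> real" where
  "mix l a b x = (if 0 < l x then max (a x) (b x) else min (a x) (b x))"

lemma mix_comp: "mix l a b \<circ> F = mix (l \<circ> F) (a \<circ> F) (b \<circ> F)"
  by (auto simp: mix_def)

text \<open>
  A mixture that takes maxima only, or minima only, oscillates no more than a and b do. Otherwise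
  a jump from a value of a to a value of b is bridged by the common value at q.
\<close>

lemma osc_mix_le:
  assumes V: "finite V" "V \<noteq> {}"
    and sides: "(\<exists>q\<in>V. a q = b q) \<or> (\<forall>x\<in>V. 0 < l x) \<or> (\<forall>x\<in>V. l x < 0)"
  shows "osc V (mix l a b) \<le> osc V a + osc V b"
proof (rule osc_least[OF V])
  fix x y assume xy: "x \<in> V" "y \<in> V"
  have oa: "\<bar>a u - a v\<bar> \<le> osc V a" and ob: "\<bar>b u - b v\<bar> \<le> osc V b"
    if "u \<in> V" "v \<in> V" for u v
    using osc_upper[OF V(1) that] by auto
  from sides consider q where "q \<in> V" "a q = b q" | "\<forall>x\<in>V. 0 < l x" | "\<forall>x\<in>V. l x < 0"
    by blast
  then show "\<bar>mix l a b x - mix l a b y\<bar> \<le> osc V a + osc V b"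
  proof cases
    case 1
    have "mix l a b u = a u \<or> mix l a b u = b u" for u
      by (auto simp: mix_def max_def min_def)
    then show ?thesis
      using oa[OF xy] ob[OF xy] oa[OF xy(1) 1(1)] oa[OF 1(1) xy(2)] ob[OF xy(1) 1(1)]
        ob[OF 1(1) xy(2)] 1(2) by (smt (verit))
  next
    case 2
    then show ?thesis using oa[OF xy] ob[OF xy] xy by (auto simp: mix_def max_def)
  next
    case 3
    then have "\<not> 0 < l x" "\<not> 0 < l y" using xy by (auto simp: less_imp_not_less)
    then show ?thesis using oa[OF xy] ob[OF xy] by (auto simp: mix_def min_def)
  qed
qed

lemma powr_add_le:
  fixes a b :: real
  assumes "0 \<le> a" "0 \<le> b" "0 \<le> p"
  shows "(a + b) powr p \<le> 2 powr p * (a powr p + b powr p)"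
proof -
  have "(a + b) powr p \<le> (2 * max a b) powr p"
    using assms by (intro powr_mono2) auto
  also have "\<dots> = 2 powr p * (max a b) powr p"
    using assms by (simp add: powr_mult)
  also have "\<dots> \<le> 2 powr p * (a powr p + b powr p)"
    by (intro mult_left_mono) (auto simp: max_def)
  finally show ?thesis .
qed


section \<open>Renormalized energies\<close>

locale renormalized_fractal = pcf_fractal N F K
  for N :: nat and F :: "nat \<Rightarrow> 'a::euclidean_space \<Rightarrow> 'a" and K :: "'a set" +
  fixes p :: real and r :: "nat \<Rightarrow> real"
  assumes p: "1 < p" and r_pos: "\<And>i. i \<in> {1..N} \<Longrightarrow> 0 < r i"
begin

definition energy :: "nat \<Rightarrow> ('a \<Rightarrow> real) \<Rightarrow> real" where
  "energy n = (renormalize N F K r ^^ n) (osc_energy p V)"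

lemma energy_0: "energy 0 = osc_energy p V"
  by (simp add: energy_def)

lemma energy_Suc: "energy (Suc n) f = energy_trace V (replicate_energy N F r (energy n)) f"
  by (simp add: energy_def renormalize_def)

lemma energy_local:
  assumes "\<And>x. x \<in> V \<Longrightarrow> f x = g x"
  shows "energy n f = energy n g"
proof (cases n)
  case 0
  then show ?thesis using osc_cong[of V f g] assms by (simp add: energy_0 osc_energy_def)
next
  case (Suc m)
  have "(\<forall>x\<in>V. f' x = f x) \<longleftrightarrow> (\<forall>x\<in>V. f' x = g x)" for f'
    using assms by (metis (no_types))
  then show ?thesis unfolding Suc energy_Suc energy_trace_def by presburger
qed

lemma replicate_energy_nonneg:
  assumes "\<And>f. 0 \<le> E f"
  shows "0 \<le> replicate_energy N F r E f"
  unfolding replicate_energy_def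
  using assms r_pos by (intro sum_nonneg mult_nonneg_nonneg) (auto simp: less_imp_le)

lemma energy_nonneg: "0 \<le> energy n f"
proof (induction n arbitrary: f)
  case 0
  then show ?case by (simp add: energy_0 osc_energy_def)
next
  case (Suc n)
  then show ?case
    unfolding energy_Suc by (intro trace_greatest replicate_energy_nonneg)
qed

lemma level1_nonneg: "0 \<le> replicate_energy N F r (energy n) f"
  by (intro replicate_energy_nonneg energy_nonneg)

lemma V_in_V1: "x \<in> V \<Longrightarrow> x \<in> (\<Union>i\<in>{1..N}. F i ` V)"
  using V_in_cell by (metis UN_I imageI)

text \<open>
  Homogeneity and invariance under constants, as an inequality that also covers \<open>t = 0\<close>.
\<close>

lemma energy_affine_le: "energy n (\<lambda>x. t * f x + s) \<le> \<bar>t\<bar> powr p * energy n f"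
proof (induction n arbitrary: f)
  case 0
  then show ?case
    using osc_affine[OF V_finite V_nonempty, of t f s] osc_nonneg[OF V_finite V_nonempty, of f]
    by (simp add: energy_0 osc_energy_def powr_mult)
next
  case (Suc n)
  show ?case unfolding energy_Suc
  proof (rule trace_le_mult_trace[OF level1_nonneg])
    fix f' assume f': "\<And>x. x \<in> V \<Longrightarrow> f' x = f x"
    have "replicate_energy N F r (energy n) (\<lambda>x. t * f' x + s)
        \<le> (\<Sum>i=1..N. inverse (r i) * (\<bar>t\<bar> powr p * energy n (f' \<circ> F i)))"
      unfolding replicate_energy_def
    proof (rule sum_mono)
      fix i assume "i \<in> {1..N}"
      then show "inverse (r i) * energy n ((\<lambda>x. t * f' x + s) \<circ> F i)
          \<le> inverse (r i) * (\<bar>t\<bar> powr p * energy n (f' \<circ> F i))"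
        using Suc.IH[of "f' \<circ> F i"] r_pos[of i] by (intro mult_left_mono) (auto simp: comp_def)
    qed
    also have "\<dots> = \<bar>t\<bar> powr p * replicate_energy N F r (energy n) f'"
      unfolding replicate_energy_def sum_distrib_left by (intro sum.cong) auto
    finally show "\<exists>g'. (\<forall>x\<in>V. g' x = t * f x + s) \<and>
        replicate_energy N F r (energy n) g' \<le> \<bar>t\<bar> powr p * replicate_energy N F r (energy n) f'"
      using f' by (intro exI[of _ "\<lambda>x. t * f' x + s"]) simp
  qed simp
qed

text \<open>
  Since the cells are linked, the oscillation on V of a function on the first level is at most a
  multiple of its largest oscillation on a cell. The constant depends on n; it only
  serves to show that no conductance vanishes.
\<close>

lemma energy_lower_bound: "\<exists>\<epsilon>>0. \<forall>f. \<epsilon> * osc V f powr p \<le> energy n f"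
proof (induction n)
  case 0
  then show ?case by (intro exI[of _ 1]) (simp add: energy_0 osc_energy_def)
next
  case (Suc n)
  then obtain \<epsilon> where \<epsilon>: "0 < \<epsilon>" "\<And>f. \<epsilon> * osc V f powr p \<le> energy n f" by blast
  let ?E = "\<Union>i\<in>{1..N}. (F i ` V) \<times> (F i ` V)"
  have "finite ?E" using V_finite by auto
  then have "\<exists>L>0. \<forall>(f :: 'a \<Rightarrow> real) B. 0 \<le> B \<longrightarrow> (\<forall>(x, y)\<in>?E. \<bar>f x - f y\<bar> \<le> B) \<longrightarrow>
      (\<forall>x\<in>(\<Union>i\<in>{1..N}. F i ` V). \<forall>y\<in>(\<Union>i\<in>{1..N}. F i ` V). \<bar>f x - f y\<bar> \<le> L * B)"
    using V1_connected by (rule chain_bound)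
  then obtain L where L: "0 < L"
    "\<forall>(f :: 'a \<Rightarrow> real) B. 0 \<le> B \<longrightarrow> (\<forall>(x, y)\<in>?E. \<bar>f x - f y\<bar> \<le> B) \<longrightarrow>
      (\<forall>x\<in>(\<Union>i\<in>{1..N}. F i ` V). \<forall>y\<in>(\<Union>i\<in>{1..N}. F i ` V). \<bar>f x - f y\<bar> \<le> L * B)"
    by (elim exE conjE)
  \<comment> \<open>The energy of the cell with the largest oscillation suffices.\<close>
  define m where "m = Min ((\<lambda>i. inverse (r i)) ` {1..N})"
  have ne: "{1..N} \<noteq> {}" using two_le_N by auto
  have m: "m \<le> inverse (r i)" if "i \<in> {1..N}" for i
    unfolding m_def using that by (intro Min_le) auto
  have "0 < m" unfolding m_def using ne r_pos by (subst Min_gr_iff) auto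
  have "m * \<epsilon> / L powr p * osc V f powr p \<le> energy (Suc n) f" for f
    unfolding energy_Suc
  proof (rule trace_greatest)
    fix f' assume f': "\<And>x. x \<in> V \<Longrightarrow> f' x = f x"
    define B where "B = Max ((\<lambda>i. osc V (f' \<circ> F i)) ` {1..N})"
    have le_B: "osc V (f' \<circ> F i) \<le> B" if "i \<in> {1..N}" for i
      unfolding B_def using that by (intro Max_ge) auto
    have "B \<in> (\<lambda>i. osc V (f' \<circ> F i)) ` {1..N}"
      unfolding B_def using ne by (intro Max_in) auto
    then obtain j where j: "j \<in> {1..N}" "B = osc V (f' \<circ> F j)" by blast
    have "0 \<le> B" unfolding j(2) by (rule osc_nonneg[OF V_finite V_nonempty])
    have "\<forall>(x, y)\<in>?E. \<bar>f' x - f' y\<bar> \<le> B"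
    proof clarify
      fix i u v assume *: "i \<in> {1..N}" "u \<in> V" "v \<in> V"
      then show "\<bar>f' (F i u) - f' (F i v)\<bar> \<le> B"
        using osc_upper[OF V_finite *(2,3), of "f' \<circ> F i"] le_B[OF *(1)] by simp
    qed
    then have "\<bar>f' x - f' y\<bar> \<le> L * B" if "x \<in> V" "y \<in> V" for x y
      using L(2) \<open>0 \<le> B\<close> V_in_V1[OF that(1)] V_in_V1[OF that(2)] by presburger
    then have "osc V f' \<le> L * B"
      by (rule osc_least[OF V_finite V_nonempty])
    then have "osc V f powr p \<le> (L * B) powr p"
      using osc_cong[of V f' f] f' osc_nonneg[OF V_finite V_nonempty, of f] p
      by (intro powr_mono2) auto
    then have "m * \<epsilon> / L powr p * osc V f powr p \<le> m * \<epsilon> / L powr p * (L * B) powr p"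
      using \<open>0 < m\<close> \<epsilon>(1) by (intro mult_left_mono) auto
    also have "\<dots> = m * (\<epsilon> * osc V (f' \<circ> F j) powr p)"
      using L(1) \<open>0 \<le> B\<close> by (simp add: powr_mult j(2)[symmetric])
    also have "\<dots> \<le> inverse (r j) * energy n (f' \<circ> F j)"
      using m[OF j(1)] \<epsilon> \<open>0 < m\<close> r_pos[OF j(1)] by (intro mult_mono) auto
    also have "\<dots> \<le> replicate_energy N F r (energy n) f'"
      unfolding replicate_energy_def using j(1) r_pos energy_nonneg
      by (intro member_le_sum) (auto simp: less_imp_le)
    finally show "m * \<epsilon> / L powr p * osc V f powr p \<le> replicate_energy N F r (energy n) f'" .
  qed
  moreover have "0 < m * \<epsilon> / L powr p" using \<open>0 < m\<close> \<epsilon>(1) L(1) by simp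
  ultimately show ?case by blast
qed

text \<open>
  One factor 2 because two mixtures are estimated, and \<open>2 powr p\<close> from the p-th power of a sum of
  two oscillations.
\<close>

abbreviation C :: real where "C \<equiv> 2 * 2 powr p"

lemma C_ge_1: "1 \<le> C"
proof -
  have "(1 :: real) \<le> 2 powr p" using p by (intro ge_one_powr_ge_zero) auto
  then show ?thesis by simp
qed

text \<open>
  The constant does not grow with n, since the estimate is passed down to the cells without loss:
  the zeros of l in a cell are again boundary points of that cell, and a and b still agree there.
  At the bottom, on a single copy of V, either l has a constant sign, or it vanishes somewhere
  in the connected set K, hence at a point of V, where a and b agree; \<open>osc_mix_le\<close> covers both cases.
\<close>

lemma energy_mix_le:
  assumes "continuous_on K l" "\<And>x. x \<in> K \<Longrightarrow> l x = 0 \<Longrightarrow> x \<in> V \<and> a x = b x"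
  shows "energy n (mix l a b) + energy n (mix (\<lambda>x. - l x) a b) \<le> C * (energy n a + energy n b)"
  using assms
proof (induction n arbitrary: l a b)
  case 0
  have "(\<exists>q\<in>V. a q = b q) \<or> (\<forall>x\<in>K. 0 < l x) \<or> (\<forall>x\<in>K. l x < 0)"
  proof (cases "\<exists>x\<in>K. l x = 0")
    case True
    then show ?thesis using 0(2) by blast
  next
    case False
    have conn: "connected (l ` K)"
      using 0(1) K_connected by (rule connected_continuous_image)
    have "False" if "x \<in> K" "y \<in> K" "l x \<le> 0" "0 \<le> l y" for x y
    proof -
      have "0 \<in> l ` K" using connectedD_interval[OF conn, of "l x" "l y" 0] that by auto
      then show False using False by auto
    qed
    then show ?thesis by (meson linorder_le_less_linear)
  qed
  then have "(\<exists>q\<in>V. a q = b q) \<or> (\<forall>x\<in>V. 0 < l x) \<or> (\<forall>x\<in>V. l x < 0)"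
    using V_subset_K by blast
  then have "osc V (mix l a b) \<le> osc V a + osc V b"
      "osc V (mix (\<lambda>x. - l x) a b) \<le> osc V a + osc V b"
    by (intro osc_mix_le[OF V_finite V_nonempty]; auto)+
  then have "osc V (mix l a b) powr p \<le> (osc V a + osc V b) powr p"
      "osc V (mix (\<lambda>x. - l x) a b) powr p \<le> (osc V a + osc V b) powr p"
    using p by (auto intro!: powr_mono2 osc_nonneg[OF V_finite V_nonempty])
  moreover have "(osc V a + osc V b) powr p \<le> 2 powr p * (osc V a powr p + osc V b powr p)"
    using p by (intro powr_add_le osc_nonneg[OF V_finite V_nonempty]) auto
  ultimately show ?case by (simp add: energy_0 osc_energy_def)
next
  case (Suc n)
  show ?case unfolding energy_Suc
  proof (rule add_trace_le_mult_add_trace[OF level1_nonneg])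
    show "0 < C" using C_ge_1 by linarith
    fix a' b' assume a': "\<And>x. x \<in> V \<Longrightarrow> a' x = a x" and b': "\<And>x. x \<in> V \<Longrightarrow> b' x = b x"
    let ?U = "replicate_energy N F r (energy n)"
    have cell: "energy n (mix l a' b' \<circ> F i) + energy n (mix (\<lambda>x. - l x) a' b' \<circ> F i)
        \<le> C * (energy n (a' \<circ> F i) + energy n (b' \<circ> F i))" if i: "i \<in> {1..N}" for i
    proof -
      have "F i ` K \<subseteq> K" using F_in_K[OF i] by auto
      then have "continuous_on (F i ` K) l"
        using Suc.prems(1) continuous_on_subset by blast
      then have "continuous_on K (l \<circ> F i)"
        using similitude_continuous[OF similitude_F[OF i]] by (rule continuous_on_compose[rotated])
      moreover have "x \<in> V \<and> (a' \<circ> F i) x = (b' \<circ> F i) x" if x: "x \<in> K" "(l \<circ> F i) x = 0" for x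
      proof -
        have "F i x \<in> V \<and> a (F i x) = b (F i x)"
          using Suc.prems(2)[OF F_in_K[OF i x(1)]] x(2) by simp
        then show ?thesis
          using V_inter_cell[OF i x(1)] a'[of "F i x"] b'[of "F i x"] by simp
      qed
      ultimately have "energy n (mix (l \<circ> F i) (a' \<circ> F i) (b' \<circ> F i))
          + energy n (mix (\<lambda>x. - (l \<circ> F i) x) (a' \<circ> F i) (b' \<circ> F i))
          \<le> C * (energy n (a' \<circ> F i) + energy n (b' \<circ> F i))"
        by (rule Suc.IH)
      moreover have "(\<lambda>x. - l x) \<circ> F i = (\<lambda>x. - (l \<circ> F i) x)" by auto
      ultimately show ?thesis by (simp only: mix_comp)
    qed
    have "?U (mix l a' b') + ?U (mix (\<lambda>x. - l x) a' b')
        = (\<Sum>i=1..N. inverse (r i) * (energy n (mix l a' b' \<circ> F i)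
            + energy n (mix (\<lambda>x. - l x) a' b' \<circ> F i)))"
      unfolding replicate_energy_def by (simp add: sum.distrib distrib_left)
    also have "\<dots> \<le> (\<Sum>i=1..N. inverse (r i) * (C * (energy n (a' \<circ> F i) + energy n (b' \<circ> F i))))"
      using cell r_pos by (intro sum_mono mult_left_mono) (auto simp: less_imp_le)
    also have "\<dots> = C * (?U a' + ?U b')"
      unfolding replicate_energy_def
      by (simp add: sum_distrib_left sum.distrib distrib_left mult_ac)
    finally show "\<exists>g' h'. (\<forall>x\<in>V. g' x = mix l a b x) \<and> (\<forall>x\<in>V. h' x = mix (\<lambda>x. - l x) a b x) \<and>
        ?U g' + ?U h' \<le> C * (?U a' + ?U b')"
      using a' b'
      by (intro exI[of _ "mix l a' b'"] exI[of _ "mix (\<lambda>x. - l x) a' b'"])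
         (simp add: mix_def)
  qed
qed

end


section \<open>Symmetry\<close>

locale symmetric_renormalized_fractal = renormalized_fractal N F K p r
  for N :: nat and F :: "nat \<Rightarrow> 'a::euclidean_space \<Rightarrow> 'a" and K :: "'a set"
    and p :: real and r :: "nat \<Rightarrow> real" +
  assumes symmetric: "symmetric_fractal N F K (reflection_group N F K)"
    and weights: "symmetric_weights N F K (reflection_group N F K) r"
begin

lemma reflection_in_group:
  assumes "y \<in> V" "z \<in> V" "y \<noteq> z"
  shows "restrict (bisector_reflection y z) K \<in> reflection_group N F K"
  unfolding reflection_group_def using assms by (intro imageI generate.incl) blast

lemma restrict_image_subset: "A \<subseteq> K \<Longrightarrow> restrict \<sigma> K ` A = \<sigma> ` A"
  by (intro image_cong) auto

lemma reflection_V: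
  assumes yz: "y \<in> V" "z \<in> V" "y \<noteq> z" and x: "x \<in> V"
  shows "bisector_reflection y z x \<in> V"
proof -
  let ?\<sigma> = "restrict (bisector_reflection y z) K"
  obtain s where s: "induces_word_perm N F K ?\<sigma> 0 s"
    using symmetric reflection_in_group[OF yz] unfolding symmetric_fractal_def by blast
  have words: "words N 0 = {[]}" by (auto simp: words_def)
  then have "s [] = []"
    using s unfolding induces_word_perm_def bij_betw_def by simp
  then have "?\<sigma> ` V = V"
    using s unfolding induces_word_perm_def by (simp add: words)
  then have "bisector_reflection y z ` V = V"
    using restrict_image_subset[OF V_subset_K] by metis
  then show ?thesis using x by blast
qed

text \<open>
  One and the same permutation has to describe the action on the cells and to preserve the weights.
\<close>

lemma reflection_cells:
  assumes yz: "y \<in> V" "z \<in> V" "y \<noteq> z"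
  shows "\<exists>s. bij_betw s {1..N} {1..N} \<and> (\<forall>i\<in>{1..N}.
    bisector_reflection y z ` F i ` K = F (s i) ` K \<and>
    bisector_reflection y z ` F i ` V = F (s i) ` V \<and> r (s i) = r i)"
proof -
  let ?\<sigma> = "restrict (bisector_reflection y z) K"
  obtain s where s: "induces_word_perm N F K ?\<sigma> 1 s" "\<forall>i\<in>{1..N}. r i = r (hd (s [i]))"
    using weights reflection_in_group[OF yz] unfolding symmetric_weights_def by blast
  have "words N 1 = (\<lambda>i. [i]) ` {1..N}"
    by (auto simp: words_def length_Suc_conv)
  moreover have "bij_betw (\<lambda>i. [i]) {1..N} ((\<lambda>i. [i]) ` {1..N})"
    by (simp add: bij_betw_def inj_on_def)
  ultimately have sing: "bij_betw (\<lambda>i. [i]) {1..N} (words N 1)" by simp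
  have hd: "bij_betw hd (words N 1) {1..N}"
    using \<open>words N 1 = (\<lambda>i. [i]) ` {1..N}\<close> by (auto simp: bij_betw_def inj_on_def image_image)
  have bij: "bij_betw s (words N 1) (words N 1)"
    using s(1) by (simp add: induces_word_perm_def)
  define s1 where "s1 i = hd (s [i])" for i
  have s1: "s [i] = [s1 i]" if "i \<in> {1..N}" for i
  proof -
    have "s [i] \<in> words N 1"
      using bij sing that by (meson bij_betwE)
    then show ?thesis by (auto simp: words_def length_Suc_conv s1_def)
  qed
  have "bij_betw (hd \<circ> (s \<circ> (\<lambda>i. [i]))) {1..N} {1..N}"
    using bij_betw_trans[OF bij_betw_trans[OF sing bij] hd] by simp
  then have "bij_betw s1 {1..N} {1..N}"
    by (simp add: s1_def[abs_def] comp_def)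
  moreover have "bisector_reflection y z ` F i ` K = F (s1 i) ` K \<and>
      bisector_reflection y z ` F i ` V = F (s1 i) ` V \<and> r (s1 i) = r i" if i: "i \<in> {1..N}" for i
  proof -
    have "[i] \<in> words N 1" using i by (simp add: words_def)
    then have "?\<sigma> ` (word_map F [i] ` K) = word_map F (s [i]) ` K \<and>
        ?\<sigma> ` (word_map F [i] ` V) = word_map F (s [i]) ` V"
      using s(1) unfolding induces_word_perm_def by blast
    moreover have "F i ` K \<subseteq> K" using F_in_K[OF i] by auto
    moreover then have "F i ` V \<subseteq> K" using V_subset_K by blast
    moreover have "r (s1 i) = r i" using s(2) i by (simp add: s1_def)
    ultimately show ?thesis
      by (simp only: restrict_image_subset s1[OF i] word_map.simps comp_id)
  qed
  ultimately show ?thesis by blast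
qed

text \<open>
  The reflection acts from a cell to its image, in the coordinates of these cells, as an
  isometry of V: it is a scaling that maps the finite set V onto itself.
\<close>

lemma cell_isometry:
  assumes yz: "y \<noteq> z" and ij: "i \<in> {1..N}" "j \<in> {1..N}"
    and cells: "bisector_reflection y z ` F i ` V = F j ` V"
  shows "\<exists>g. (\<forall>x\<in>V. g x \<in> V \<and> F j (g x) = bisector_reflection y z (F i x)) \<and>
    (\<forall>x\<in>V. \<forall>y\<in>V. dist (g x) (g y) = dist x y)"
proof -
  let ?\<rho> = "bisector_reflection y z"
  have "\<forall>x\<in>V. \<exists>v. v \<in> V \<and> F j v = ?\<rho> (F i x)"
  proof
    fix x assume "x \<in> V"
    then have "?\<rho> (F i x) \<in> F j ` V" using cells by blast
    then show "\<exists>v. v \<in> V \<and> F j v = ?\<rho> (F i x)" by force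
  qed
  then obtain g where g: "\<And>x. x \<in> V \<Longrightarrow> g x \<in> V \<and> F j (g x) = ?\<rho> (F i x)"
    by metis
  have "g ` V = V"
  proof (intro equalityI subsetI)
    fix v assume v: "v \<in> V"
    then have "F j v \<in> ?\<rho> ` F i ` V" using cells by blast
    then obtain x where x: "x \<in> V" "F j v = ?\<rho> (F i x)" by blast
    then have "F j v = F j (g x)" using g by simp
    then show "v \<in> g ` V" using F_eq_iff[OF ij(2)] x(1) by blast
  qed (use g in blast)
  obtain \<alpha> where \<alpha>: "0 < \<alpha>" "\<alpha> < 1" "\<And>x y. dist (F i x) (F i y) = \<alpha> * dist x y"
    using similitude_dist[OF similitude_F[OF ij(1)]] by blast
  obtain \<beta> where \<beta>: "0 < \<beta>" "\<beta> < 1" "\<And>x y. dist (F j x) (F j y) = \<beta> * dist x y"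
    using similitude_dist[OF similitude_F[OF ij(2)]] by blast
  have scale: "dist (g u) (g v) = (\<alpha> / \<beta>) * dist u v" if "u \<in> V" "v \<in> V" for u v
  proof -
    have "\<beta> * dist (g u) (g v) = \<alpha> * dist u v"
      using g[OF that(1)] g[OF that(2)] dist_bisector_reflection[OF yz, of "F i u" "F i v"]
      by (simp flip: \<alpha>(3) \<beta>(3))
    then show ?thesis using \<beta>(1) by (simp add: field_simps)
  qed
  obtain a where "a \<in> V" using V_nonempty by blast
  moreover obtain b where "b \<in> V" "b \<noteq> a" using V_other_point by blast
  ultimately have "\<alpha> / \<beta> = 1"
    using scaling_of_finite_set[OF V_finite, of a b g] \<open>g ` V = V\<close> scale by blast
  then show ?thesis using g scale by (intro exI[of _ g]) simp
qed

text \<open>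
  The reflection permutes the cells and their weights. Between two corresponding cells it acts as
  an isometry of V, which need not belong to the reflection group, but on V it coincides with a
  product of reflections, under which the energy of the previous level is invariant.
\<close>

lemma energy_reflection:
  assumes "y \<in> V" "z \<in> V" "y \<noteq> z"
  shows "energy n (f \<circ> bisector_reflection y z) = energy n f"
  using assms
proof (induction n arbitrary: y z f)
  case 0
  let ?\<rho> = "bisector_reflection y z"
  have "osc V (h \<circ> ?\<rho>) \<le> osc V h" for h
    using osc_upper[OF V_finite reflection_V[OF 0] reflection_V[OF 0]]
    by (intro osc_least[OF V_finite V_nonempty]) simp
  from this[of f] this[of "f \<circ> ?\<rho>"] have "osc V (f \<circ> ?\<rho>) = osc V f"
    using bisector_reflection_involution[OF 0(3)] by (simp add: comp_def)
  then show ?case by (simp only: energy_0 osc_energy_def)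
next
  case (Suc n)
  let ?\<rho> = "bisector_reflection y z"
  let ?U = "replicate_energy N F r (energy n)"
  note yz = Suc.prems
  obtain s where s: "bij_betw s {1..N} {1..N}" and cells: "\<forall>i\<in>{1..N}.
      ?\<rho> ` F i ` K = F (s i) ` K \<and> ?\<rho> ` F i ` V = F (s i) ` V \<and> r (s i) = r i"
    using reflection_cells[OF yz] by blast
  have cell: "energy n (h \<circ> ?\<rho> \<circ> F i) = energy n (h \<circ> F (s i))" if i: "i \<in> {1..N}" for h i
  proof -
    have si: "s i \<in> {1..N}" using s i by (rule bij_betwE[THEN bspec])
    obtain g where g: "\<forall>x\<in>V. g x \<in> V \<and> F (s i) (g x) = ?\<rho> (F i x)"
        "\<forall>x\<in>V. \<forall>y\<in>V. dist (g x) (g y) = dist x y"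
      using cell_isometry[OF yz(3) i si] cells i by blast
    have "energy n (h \<circ> ?\<rho> \<circ> F i) = energy n ((h \<circ> F (s i)) \<circ> g)"
      using g(1) by (intro energy_local) simp
    also have "\<dots> = energy n (h \<circ> F (s i))"
      using g by (intro invariant_under_isometries[OF V_finite energy_local reflection_V Suc.IH]) auto
    finally show ?thesis .
  qed
  have U: "?U (h \<circ> ?\<rho>) = ?U h" for h
  proof -
    have "?U (h \<circ> ?\<rho>) = (\<Sum>i=1..N. inverse (r (s i)) * energy n (h \<circ> F (s i)))"
      unfolding replicate_energy_def using cell cells by (intro sum.cong) auto
    also have "\<dots> = ?U h"
      unfolding replicate_energy_def
      using sum.reindex_bij_betw[OF s, of "\<lambda>i. inverse (r i) * energy n (h \<circ> F i)"] .
    finally show ?thesis .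
  qed
  have le: "energy (Suc n) (h \<circ> ?\<rho>) \<le> 1 * energy (Suc n) h" for h
    unfolding energy_Suc
  proof (rule trace_le_mult_trace[OF level1_nonneg])
    fix h' assume h': "\<And>x. x \<in> V \<Longrightarrow> h' x = h x"
    show "\<exists>g'. (\<forall>x\<in>V. g' x = (h \<circ> ?\<rho>) x) \<and> ?U g' \<le> 1 * ?U h'"
      using h' reflection_V[OF yz] U by (intro exI[of _ "h' \<circ> ?\<rho>"]) simp
  qed simp
  have "f \<circ> ?\<rho> \<circ> ?\<rho> = f"
    using bisector_reflection_involution[OF yz(3)] by auto
  then have "energy (Suc n) f \<le> energy (Suc n) (f \<circ> ?\<rho>)"
    using le[of "f \<circ> ?\<rho>"] by (simp only: mult_1)
  then show ?case using le[of f] by linarith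
qed

lemma energy_isometry:
  assumes "\<And>x. x \<in> V \<Longrightarrow> g x \<in> V" "\<And>x y. x \<in> V \<Longrightarrow> y \<in> V \<Longrightarrow> dist (g x) (g y) = dist x y"
  shows "energy n (f \<circ> g) = energy n f"
  using assms
  by (intro invariant_under_isometries[OF V_finite energy_local reflection_V energy_reflection]) auto


section \<open>Polarization\<close>

text \<open>
  The two-point rearrangement of f: in every pair of mirror images, the larger value of f goes to
  the point on the side of y.
\<close>

definition polarize :: "'a \<Rightarrow> 'a \<Rightarrow> ('a \<Rightarrow> real) \<Rightarrow> 'a \<Rightarrow> real" where
  "polarize y z f = mix (side y z) f (f \<circ> bisector_reflection y z)"

text \<open>
  The hyperplane is compared with the cells of the first level. A cell that the reflection maps to
  itself sees either the identity on its boundary or the reflection between two of its own boundary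
  points, so the induction hypothesis applies with the same constant. A cell that is exchanged with
  another one meets the hyperplane in common points of both cells only, that is in boundary
  points, where f and its reflection agree: this is the situation of \<open>energy_mix_le\<close>. Such a
  cell may have boundary points on both sides, which is why polarization may increase the energy.
\<close>

lemma energy_polarize_le:
  assumes "y \<in> V" "z \<in> V" "y \<noteq> z"
  shows "energy n (polarize y z f) \<le> C * energy n f"
  using assms
proof (induction n arbitrary: y z f)
  case 0
  have "osc V (polarize y z f) \<le> osc V f"
  proof (rule osc_least[OF V_finite V_nonempty])
    have *: "\<exists>x'\<in>V. polarize y z f x = f x'" if "x \<in> V" for x
      using that reflection_V[OF 0 that] by (auto simp: polarize_def mix_def max_def min_def)
    fix u v assume "u \<in> V" "v \<in> V"
    then obtain u' v' where "u' \<in> V" "v' \<in> V" "polarize y z f u = f u'" "polarize y z f v = f v'"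
      using * by meson
    then show "\<bar>polarize y z f u - polarize y z f v\<bar> \<le> osc V f"
      using osc_upper[OF V_finite] by simp
  qed
  then have "osc V (polarize y z f) powr p \<le> 1 * osc V f powr p"
    using p osc_nonneg[OF V_finite V_nonempty] by (simp add: powr_mono2)
  also have "\<dots> \<le> C * osc V f powr p"
    using C_ge_1 by (intro mult_right_mono) auto
  finally show ?case by (simp add: energy_0 osc_energy_def)
next
  case (Suc n)
  let ?\<rho> = "bisector_reflection y z" and ?l = "side y z"
  let ?U = "replicate_energy N F r (energy n)"
  note yz = Suc.prems
  obtain s where s: "bij_betw s {1..N} {1..N}" and cells: "\<forall>i\<in>{1..N}.
      ?\<rho> ` F i ` K = F (s i) ` K \<and> ?\<rho> ` F i ` V = F (s i) ` V \<and> r (s i) = r i"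
    using reflection_cells[OF yz] by blast
  have cell: "energy n (polarize y z h \<circ> F i) + energy n (polarize y z h \<circ> F (s i))
      \<le> C * (energy n (h \<circ> F i) + energy n (h \<circ> F (s i)))" if i: "i \<in> {1..N}" for h i
  proof -
    have si: "s i \<in> {1..N}" using s i by (rule bij_betwE[THEN bspec])
    have iK: "?\<rho> ` F i ` K = F (s i) ` K" and iV: "?\<rho> ` F i ` V = F (s i) ` V"
      using cells i by auto
    show ?thesis
    proof (cases "s i = i")
      case True
      have "energy n (polarize y z h \<circ> F i) \<le> C * energy n (h \<circ> F i)"
      proof (cases "\<forall>v\<in>V. ?\<rho> (F i v) = F i v")
        case True
        then have "energy n (polarize y z h \<circ> F i) = energy n (h \<circ> F i)"
          by (intro energy_local) (simp add: polarize_def mix_def)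
        also have "\<dots> \<le> C * energy n (h \<circ> F i)"
          using mult_right_mono[OF C_ge_1 energy_nonneg, of n "h \<circ> F i"] by simp
        finally show ?thesis .
      next
        case False
        then obtain w where w: "w \<in> V" "?\<rho> (F i w) \<noteq> F i w" by blast
        have stable: "\<exists>w'\<in>V. F i w' = ?\<rho> (F i w)" if "w \<in> V" for w
        proof -
          have "?\<rho> (F i w) \<in> F i ` V" using iV True that by (metis imageI)
          then show ?thesis by force
        qed
        obtain w' where w': "w' \<in> V" "F i w' = ?\<rho> (F i w)" using stable[OF w(1)] by blast
        \<comment> \<open>The pair is ordered such that both reflections favour the same side.\<close>
        have "\<exists>v\<in>V. 0 < ?l (F i v)"
        proof -
          have "?l (F i w) \<noteq> 0" using w(2) bisector_reflection_eq_iff[OF yz(3)] by blast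
          moreover have "?l (F i w') = - ?l (F i w)"
            using w'(2) side_bisector_reflection[OF yz(3)] by simp
          ultimately have "0 < ?l (F i w) \<or> 0 < ?l (F i w')" by linarith
          then show ?thesis using w(1) w'(1) by blast
        qed
        then obtain v where v: "v \<in> V" "0 < ?l (F i v)" by blast
        obtain u where u: "u \<in> V" "F i u = ?\<rho> (F i v)" using stable[OF v(1)] by blast
        have "v \<noteq> u"
          using u(2) v(2) bisector_reflection_eq_iff[OF yz(3), of "F i v"] by auto
        note same = bisector_reflection_of_image[OF yz(3) u(2) v(2)]
        have "polarize y z h \<circ> F i = polarize v u (h \<circ> F i)"
        proof
          fix x
          have "?\<rho> (F i x) = F i (bisector_reflection v u x)"
            using same(1) similitude_bisector_reflection[OF similitude_F[OF i], of v u x] by simp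
          moreover have "0 < ?l (F i x) \<longleftrightarrow> 0 < side v u x"
            using same(2)[of "F i x"] similitude_side_pos_iff[OF similitude_F[OF i], of v u x] by simp
          ultimately show "(polarize y z h \<circ> F i) x = polarize v u (h \<circ> F i) x"
            by (simp add: polarize_def mix_def)
        qed
        then show ?thesis using Suc.IH[OF v(1) u(1) \<open>v \<noteq> u\<close>] by simp
      qed
      then show ?thesis using True by simp
    next
      case False
      \<comment> \<open>In the coordinates of the cell i, the two mixtures of a and b are the restrictions of the
        polarization to the cell i and to its mirror image.\<close>
      define l where "l = ?l \<circ> F i"
      define a where "a = h \<circ> F i"
      define b where "b = h \<circ> ?\<rho> \<circ> F i"
      obtain g where g: "\<forall>x\<in>V. g x \<in> V \<and> F (s i) (g x) = ?\<rho> (F i x)"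
          "\<forall>x\<in>V. \<forall>y\<in>V. dist (g x) (g y) = dist x y"
        using cell_isometry[OF yz(3) i si iV] by blast
      have g_inv: "energy n (f \<circ> g) = energy n f" for f
        using g by (intro energy_isometry) auto
      have "continuous_on K l"
        unfolding l_def side_def comp_def using similitude_continuous[OF similitude_F[OF i]]
        by (intro continuous_intros)
      moreover have "x \<in> V \<and> a x = b x" if x: "x \<in> K" "l x = 0" for x
      proof -
        have "?\<rho> (F i x) = F i x"
          using x(2) bisector_reflection_eq_iff[OF yz(3)] by (simp add: l_def)
        moreover then have "F i x \<in> F (s i) ` K" using iK x(1) by (metis imageI)
        ultimately show ?thesis
          using cell_intersection[OF i si _ x(1)] False by (auto simp: a_def b_def)
      qed
      ultimately have "energy n (mix l a b) + energy n (mix (\<lambda>x. - l x) a b)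
          \<le> C * (energy n a + energy n b)"
        by (rule energy_mix_le)
      moreover have "mix l a b = polarize y z h \<circ> F i"
        by (simp add: polarize_def mix_comp l_def a_def b_def comp_assoc)
      moreover have "energy n (mix (\<lambda>x. - l x) a b) = energy n (polarize y z h \<circ> F (s i))"
      proof -
        have "energy n (mix (\<lambda>x. - l x) a b) = energy n ((polarize y z h \<circ> F (s i)) \<circ> g)"
        proof (rule energy_local)
          fix x assume "x \<in> V"
          then have "F (s i) (g x) = ?\<rho> (F i x)" using g(1) by blast
          then show "mix (\<lambda>x. - l x) a b x = ((polarize y z h \<circ> F (s i)) \<circ> g) x"
            by (simp add: polarize_def mix_def l_def a_def b_def side_bisector_reflection[OF yz(3)]
                bisector_reflection_involution[OF yz(3)] max.commute min.commute)
        qed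
        then show ?thesis using g_inv by simp
      qed
      moreover have "energy n b = energy n (h \<circ> F (s i))"
      proof -
        have "energy n b = energy n ((h \<circ> F (s i)) \<circ> g)"
          using g(1) by (intro energy_local) (simp add: b_def)
        then show ?thesis using g_inv by simp
      qed
      ultimately show ?thesis by (simp add: a_def)
    qed
  qed
  \<comment> \<open>Each cell is counted once for itself and once as the mirror image of a cell.\<close>
  have twice: "2 * ?U h = (\<Sum>i=1..N. inverse (r i) * (energy n (h \<circ> F i) + energy n (h \<circ> F (s i))))"
    for h
  proof -
    have "?U h = (\<Sum>i=1..N. inverse (r (s i)) * energy n (h \<circ> F (s i)))"
      unfolding replicate_energy_def
      using sum.reindex_bij_betw[OF s, of "\<lambda>i. inverse (r i) * energy n (h \<circ> F i)"] by simp
    also have "\<dots> = (\<Sum>i=1..N. inverse (r i) * energy n (h \<circ> F (s i)))"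
      using cells by (intro sum.cong) auto
    finally show ?thesis
      by (simp add: distrib_left sum.distrib replicate_energy_def)
  qed
  show ?case unfolding energy_Suc
  proof (rule trace_le_mult_trace[OF level1_nonneg])
    show "0 \<le> C" using C_ge_1 by linarith
    fix f' assume f': "\<And>x. x \<in> V \<Longrightarrow> f' x = f x"
    have "2 * ?U (polarize y z f') \<le>
        (\<Sum>i=1..N. inverse (r i) * (C * (energy n (f' \<circ> F i) + energy n (f' \<circ> F (s i)))))"
      unfolding twice using cell r_pos by (intro sum_mono mult_left_mono) (auto simp: less_imp_le)
    also have "\<dots> = C * (2 * ?U f')"
      unfolding twice sum_distrib_left by (intro sum.cong) (auto simp: mult_ac)
    finally have "?U (polarize y z f') \<le> C * ?U f'" by linarith
    then show "\<exists>g'. (\<forall>x\<in>V. g' x = polarize y z f x) \<and> ?U g' \<le> C * ?U f'"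
      using f' reflection_V[OF yz]
      by (intro exI[of _ "polarize y z f'"]) (simp add: polarize_def mix_def)
  qed
qed

end

lemma dist_bisector_reflection_self:
  assumes "y \<noteq> z"
  shows "dist x (bisector_reflection y z x) * dist y z = 2 * \<bar>side y z x\<bar>"
proof -
  have "x - bisector_reflection y z x = (2 * side y z x / ((y - z) \<bullet> (y - z))) *\<^sub>R (y - z)"
    by (simp add: bisector_reflection_side)
  then have "dist x (bisector_reflection y z x) = 2 * \<bar>side y z x\<bar> / (dist y z)\<^sup>2 * dist y z"
    by (simp add: dist_norm power2_norm_eq_inner abs_mult)
  then show ?thesis using assms by (simp add: power2_eq_square)
qed

context symmetric_renormalized_fractal
begin


section \<open>Chains of nearest neighbours\<close>

definition spacing :: real where
  "spacing = Min {dist x y | x y. x \<in> V \<and> y \<in> V \<and> x \<noteq> y}"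

definition neighbours :: "('a \<times> 'a) set" where
  "neighbours = {(x, y). x \<in> V \<and> y \<in> V \<and> x \<noteq> y \<and> dist x y = spacing}"

lemma pairs_image:
  "{h x y | x y. x \<in> V \<and> y \<in> V \<and> x \<noteq> y} = (\<lambda>(x, y). h x y) ` {(x, y). x \<in> V \<and> y \<in> V \<and> x \<noteq> y}"
  by auto

lemma pairs_finite: "finite {h x y | x y. x \<in> V \<and> y \<in> V \<and> x \<noteq> y}"
  unfolding pairs_image
  by (intro finite_imageI finite_subset[OF _ finite_cartesian_product[OF V_finite V_finite]]) auto

lemma pairs_nonempty: "{h x y | x y. x \<in> V \<and> y \<in> V \<and> x \<noteq> y} \<noteq> {}"
proof -
  obtain x where "x \<in> V" using V_nonempty by blast
  moreover obtain y where "y \<in> V" "y \<noteq> x" using V_other_point by blast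
  ultimately show ?thesis by blast
qed

lemma spacing_le: "x \<in> V \<Longrightarrow> y \<in> V \<Longrightarrow> x \<noteq> y \<Longrightarrow> spacing \<le> dist x y"
  unfolding spacing_def by (rule Min_le[OF pairs_finite]) blast

lemma neighbours_exist: "\<exists>x y. (x, y) \<in> neighbours"
proof -
  have "spacing \<in> {dist x y | x y. x \<in> V \<and> y \<in> V \<and> x \<noteq> y}"
    unfolding spacing_def by (rule Min_in[OF pairs_finite pairs_nonempty])
  then obtain x y where "x \<in> V" "y \<in> V" "x \<noteq> y" "spacing = dist x y" by blast
  then have "(x, y) \<in> neighbours" by (simp add: neighbours_def)
  then show ?thesis by blast
qed

lemma spacing_pos: "0 < spacing"
proof -
  obtain x y where "(x, y) \<in> neighbours" using neighbours_exist by blast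
  then have "x \<noteq> y" "spacing = dist x y" by (simp_all add: neighbours_def)
  then show ?thesis by simp
qed

lemma neighbours_reflection:
  assumes "y \<in> V" "z \<in> V" "y \<noteq> z" "(u, v) \<in> neighbours"
  shows "(bisector_reflection y z u, bisector_reflection y z v) \<in> neighbours"
proof -
  have "bisector_reflection y z u \<noteq> bisector_reflection y z v"
    using assms dist_bisector_reflection[OF assms(3), of u v] by (auto simp: neighbours_def)
  then show ?thesis
    using assms by (simp add: neighbours_def reflection_V dist_bisector_reflection)
qed

lemma neighbour_exists:
  assumes a: "a \<in> V"
  shows "\<exists>b. (a, b) \<in> neighbours"
proof -
  obtain u v where uv: "(u, v) \<in> neighbours" using neighbours_exist by blast
  then have "u \<in> V" by (simp add: neighbours_def)
  show ?thesis
  proof (cases "u = a")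
    case False
    then show ?thesis
      using neighbours_reflection[OF \<open>u \<in> V\<close> a False uv] bisector_reflection_swap by metis
  qed (use uv in blast)
qed

lemma neighbours_sym: "(x, y) \<in> neighbours \<Longrightarrow> (y, x) \<in> neighbours"
  by (auto simp: neighbours_def dist_commute)

text \<open>
  Otherwise choose a in a component A and b outside of A at the minimal distance m, and a neighbour
  c of a. The reflection exchanging c and b takes a, a neighbour of c, to a neighbour of b, hence
  to a point outside of A. So the parallel segments from c to b and from a to its mirror image both
  have length at least m. In the isosceles trapezoid that they span,
  \<open>(dist a b)\<^sup>2 = (dist a c)\<^sup>2 + dist c b * dist a a' > m\<^sup>2\<close>, where a' is the mirror image of a.
\<close>

lemma neighbours_connected:
  assumes "x \<in> V" "w \<in> V"
  shows "(x, w) \<in> neighbours\<^sup>*"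
proof (rule ccontr)
  assume "(x, w) \<notin> neighbours\<^sup>*"
  define A where "A = {a \<in> V. (x, a) \<in> neighbours\<^sup>*}"
  define D where "D = (\<lambda>(a, b). dist a b) ` (A \<times> (V - A))"
  have A: "A \<subseteq> V" "x \<in> A" "w \<in> V - A"
    using assms \<open>(x, w) \<notin> neighbours\<^sup>*\<close> by (auto simp: A_def)
  have "finite A" using A(1) V_finite finite_subset by blast
  then have D: "finite D" "D \<noteq> {}" using V_finite A by (auto simp: D_def)
  have min: "Min D \<le> dist a b" if "a \<in> A" "b \<in> V - A" for a b
    using that by (intro Min_le[OF D(1)]) (auto simp: D_def)
  have "Min D \<in> D" using Min_in[OF D] .
  then obtain a b where ab: "a \<in> A" "b \<in> V - A" "Min D = dist a b"
    by (auto simp: D_def)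
  have closed: "v \<in> A" if "u \<in> A" "(u, v) \<in> neighbours" for u v
    using that by (auto simp: A_def neighbours_def intro: rtrancl_into_rtrancl)
  obtain c where c: "(a, c) \<in> neighbours"
    using neighbour_exists ab(1) A(1) by blast
  have cA: "c \<in> A" using closed[OF ab(1) c] .
  have cb: "c \<in> V" "b \<in> V" "c \<noteq> b" using cA ab(2) A(1) by auto
  let ?\<rho> = "bisector_reflection c b"
  have "(?\<rho> c, ?\<rho> a) \<in> neighbours"
    using neighbours_reflection[OF cb neighbours_sym[OF c]] .
  then have edge: "(?\<rho> a, b) \<in> neighbours"
    using bisector_reflection_swap[OF cb(3)] neighbours_sym by simp
  then have "?\<rho> a \<notin> A" using closed ab(2) by blast
  moreover have "?\<rho> a \<in> V" using edge by (simp add: neighbours_def)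
  ultimately have "Min D \<le> dist a (?\<rho> a)" using min[OF ab(1)] by blast
  moreover have "Min D \<le> dist c b" using min[OF cA ab(2)] .
  moreover have "0 \<le> Min D" using ab(3) by simp
  ultimately have "Min D * Min D \<le> dist a (?\<rho> a) * dist c b"
    by (intro mult_mono) auto
  also have "\<dots> = 2 * \<bar>side c b a\<bar>" by (rule dist_bisector_reflection_self[OF cb(3)])
  finally have 1: "(Min D)\<^sup>2 \<le> 2 * \<bar>side c b a\<bar>" by (simp add: power2_eq_square)
  have ac: "dist a c = spacing" using c by (simp add: neighbours_def)
  have "a \<noteq> b" "a \<in> V" using ab A(1) by auto
  then have "spacing \<le> dist a b" using spacing_le cb(2) by blast
  then have "(dist a c)\<^sup>2 \<le> (dist a b)\<^sup>2"
    using ac spacing_pos by (intro power_mono) auto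
  moreover have eq: "(dist a b)\<^sup>2 - (dist a c)\<^sup>2 = 2 * side c b a" by (rule dist_side)
  ultimately have "\<bar>side c b a\<bar> = side c b a" by linarith
  then have "(dist a c)\<^sup>2 \<le> 0" using 1 eq unfolding ab(3) by linarith
  then show False using ac spacing_pos by simp
qed


section \<open>Comparison of resistances\<close>

definition conductance :: "nat \<Rightarrow> 'a \<Rightarrow> 'a \<Rightarrow> real" where
  "conductance n x y = Inf {energy n f | f. f x = 0 \<and> f y = 1}"

text \<open>
  Any function that separates x and y yields a test function after an affine normalization.
\<close>

lemma conductance_le:
  assumes "0 < c" "c \<le> \<bar>f y - f x\<bar>"
  shows "conductance n x y \<le> (1 / c) powr p * energy n f"
proof -
  define t where "t = 1 / (f y - f x)"
  define g where "g = (\<lambda>z. t * f z + (- t * f x))"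
  have "f y \<noteq> f x" using assms by auto
  moreover have "g z = (f z - f x) / (f y - f x)" for z
    by (simp add: g_def t_def diff_divide_distrib)
  ultimately have g: "g x = 0" "g y = 1" by simp_all
  have "conductance n x y \<le> energy n g"
    unfolding conductance_def
    by (rule cInf_lower) (use g energy_nonneg in \<open>auto intro!: bdd_belowI[of _ 0]\<close>)
  also have "\<dots> \<le> \<bar>t\<bar> powr p * energy n f"
    unfolding g_def by (rule energy_affine_le)
  also have "\<dots> \<le> (1 / c) powr p * energy n f"
    using assms p energy_nonneg[of n f]
    by (intro mult_right_mono powr_mono2) (auto simp: t_def intro!: divide_left_mono)
  finally show ?thesis .
qed

lemma conductance_greatest:
  assumes "x \<noteq> y" "\<And>f. f x = 0 \<Longrightarrow> f y = 1 \<Longrightarrow> c \<le> energy n f"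
  shows "c \<le> conductance n x y"
  unfolding conductance_def
proof (rule cInf_greatest)
  show "{energy n f |f. f x = 0 \<and> f y = 1} \<noteq> {}"
    using assms(1) by (auto intro!: exI[of _ "\<lambda>z. if z = y then 1 else 0"])
qed (use assms(2) in auto)

lemma conductance_pos:
  assumes "x \<in> V" "y \<in> V" "x \<noteq> y"
  shows "0 < conductance n x y"
proof -
  obtain \<epsilon> where \<epsilon>: "0 < \<epsilon>" "\<And>f. \<epsilon> * osc V f powr p \<le> energy n f"
    using energy_lower_bound by blast
  have "\<epsilon> \<le> conductance n x y"
  proof (rule conductance_greatest[OF assms(3)])
    fix f :: "'a \<Rightarrow> real" assume "f x = 0" "f y = 1"
    then have "1 \<le> osc V f" using osc_upper[OF V_finite assms(1,2), of f] by simp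
    then have "1 \<le> osc V f powr p" using p by (intro ge_one_powr_ge_zero) auto
    then have "\<epsilon> * 1 \<le> \<epsilon> * osc V f powr p" using \<epsilon>(1) by (intro mult_left_mono) auto
    also have "\<dots> \<le> energy n f" using \<epsilon>(2) .
    finally show "\<epsilon> \<le> energy n f" by simp
  qed
  then show ?thesis using \<epsilon>(1) by linarith
qed

text \<open>
  Let \<open>(s, y)\<close> be a pair of neighbours. As y is at least as close to s as t is, polarization between
  t and y raises the value at t to at least the value at y without raising the value at s.
\<close>

lemma conductance_le_of_neighbours:
  assumes ab: "(a, b) \<in> neighbours" and c: "0 < c" "c \<le> h b - h a"
    and st: "s \<in> V" "t \<in> V" "s \<noteq> t"
  shows "conductance n s t \<le> (1 / c) powr p * (C * energy n h)"
proof -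
  have aV: "a \<in> V" using ab by (simp add: neighbours_def)
  \<comment> \<open>Move the pair so that it starts at s.\<close>
  have "\<exists>g y. (s, y) \<in> neighbours \<and> c \<le> g y - g s \<and> energy n g = energy n h"
  proof (cases "a = s")
    case True
    then show ?thesis using ab c by blast
  next
    case False
    let ?\<rho> = "bisector_reflection a s"
    have "?\<rho> a = s" by (rule bisector_reflection_swap[OF False])
    moreover then have "?\<rho> s = a" using bisector_reflection_involution[OF False] by metis
    ultimately have "(s, ?\<rho> b) \<in> neighbours" "c \<le> (h \<circ> ?\<rho>) (?\<rho> b) - (h \<circ> ?\<rho>) s"
      using neighbours_reflection[OF aV st(1) False ab] bisector_reflection_involution[OF False] c
      by simp_all
    then show ?thesis using energy_reflection[OF aV st(1) False] by blast
  qed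
  then obtain g y where gy: "(s, y) \<in> neighbours" "c \<le> g y - g s" "energy n g = energy n h"
    by blast
  have y: "y \<in> V" "dist s y \<le> dist s t"
    using gy(1) spacing_le[OF st] by (simp_all add: neighbours_def)
  show ?thesis
  proof (cases "y = t")
    case True
    have "conductance n s t \<le> (1 / c) powr p * energy n g"
      using gy(2) True by (intro conductance_le[OF c(1)]) simp
    also have "\<dots> \<le> (1 / c) powr p * (C * energy n h)"
      using mult_right_mono[OF C_ge_1 energy_nonneg, of n h] gy(3) by (intro mult_left_mono) auto
    finally show ?thesis .
  next
    case False
    then have ty: "t \<noteq> y" by simp
    have "g y \<le> polarize t y g t"
    proof -
      have "0 < side t y t" using ty by (simp add: side_pos_iff)
      then show ?thesis
        using bisector_reflection_swap[OF ty] by (simp add: polarize_def mix_def)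
    qed
    moreover have "polarize t y g s \<le> g s"
    proof -
      have "\<not> 0 < side t y s" using y(2) by (simp add: side_pos_iff)
      then show ?thesis by (simp add: polarize_def mix_def)
    qed
    ultimately have "conductance n s t \<le> (1 / c) powr p * energy n (polarize t y g)"
      using gy(2) by (intro conductance_le[OF c(1)]) linarith
    also have "\<dots> \<le> (1 / c) powr p * (C * energy n h)"
      using energy_polarize_le[OF st(2) y(1) ty, of n g] gy(3) by (intro mult_left_mono) auto
    finally show ?thesis .
  qed
qed

text \<open>
  A function with values 0 at u and 1 at v has a jump of a definite size across some pair of
  neighbours, since these connect u to v.
\<close>

lemma conductances_comparable:
  "\<exists>Q>0. \<forall>n. \<forall>s\<in>V. \<forall>t\<in>V. \<forall>u\<in>V. \<forall>v\<in>V. s \<noteq> t \<longrightarrow> u \<noteq> v \<longrightarrow>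
    conductance n s t \<le> Q * conductance n u v"
proof -
  have "neighbours \<subseteq> V \<times> V" by (auto simp: neighbours_def)
  then have "finite neighbours" using V_finite finite_subset by blast
  then have "\<exists>L>0. \<forall>(f :: 'a \<Rightarrow> real) B. 0 \<le> B \<longrightarrow> (\<forall>(x, y)\<in>neighbours. \<bar>f x - f y\<bar> \<le> B) \<longrightarrow>
      (\<forall>x\<in>V. \<forall>y\<in>V. \<bar>f x - f y\<bar> \<le> L * B)"
    using neighbours_connected by (rule chain_bound)
  then obtain L where L: "0 < L"
    "\<forall>(f :: 'a \<Rightarrow> real) B. 0 \<le> B \<longrightarrow> (\<forall>(x, y)\<in>neighbours. \<bar>f x - f y\<bar> \<le> B) \<longrightarrow>
      (\<forall>x\<in>V. \<forall>y\<in>V. \<bar>f x - f y\<bar> \<le> L * B)"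
    by (elim exE conjE)
  define c where "c = 1 / (2 * L)"
  define Q where "Q = (1 / c) powr p * C"
  have "0 < c" using L(1) by (simp add: c_def)
  have "0 < Q" using \<open>0 < c\<close> by (simp add: Q_def)
  have "conductance n s t \<le> Q * conductance n u v"
    if st: "s \<in> V" "t \<in> V" "s \<noteq> t" and uv: "u \<in> V" "v \<in> V" "u \<noteq> v" for n s t u v
  proof -
    have "conductance n s t / Q \<le> conductance n u v"
    proof (rule conductance_greatest[OF uv(3)])
      fix h :: "'a \<Rightarrow> real" assume h: "h u = 0" "h v = 1"
      have "\<exists>a b. (a, b) \<in> neighbours \<and> c < \<bar>h a - h b\<bar>"
      proof (rule ccontr)
        assume "\<not> ?thesis"
        then have "\<forall>(a, b)\<in>neighbours. \<bar>h a - h b\<bar> \<le> c" by force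
        then have "\<bar>h u - h v\<bar> \<le> L * c"
          using L(2) \<open>0 < c\<close> uv(1,2) by (meson less_imp_le)
        then show False using h L(1) by (simp add: c_def)
      qed
      then obtain a b where ab: "(a, b) \<in> neighbours" "c < \<bar>h a - h b\<bar>" by blast
      have "conductance n s t \<le> (1 / c) powr p * (C * energy n h)"
      proof (cases "h a \<le> h b")
        case True
        then show ?thesis
          using ab(2) by (intro conductance_le_of_neighbours[OF ab(1) \<open>0 < c\<close> _ st]) simp
      next
        case False
        then show ?thesis
          using ab(2)
          by (intro conductance_le_of_neighbours[OF neighbours_sym[OF ab(1)] \<open>0 < c\<close> _ st]) simp
      qed
      then show "conductance n s t / Q \<le> energy n h"
        using \<open>0 < Q\<close> by (simp add: Q_def divide_le_eq mult_ac)
    qed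
    then show ?thesis using \<open>0 < Q\<close> by (simp add: divide_le_eq mult_ac)
  qed
  then show ?thesis using \<open>0 < Q\<close> by blast
qed

lemma resistance_energy: "x \<noteq> y \<Longrightarrow> resistance (energy n) x y = 1 / conductance n x y"
  by (simp add: resistance_def conductance_def)

lemma resistance_ratio_bounded_below:
  "\<exists>c>0. \<forall>n. c \<le> resistance_ratio V (energy n)"
proof -
  obtain Q where Q: "0 < Q"
    "\<forall>n. \<forall>s\<in>V. \<forall>t\<in>V. \<forall>u\<in>V. \<forall>v\<in>V. s \<noteq> t \<longrightarrow> u \<noteq> v \<longrightarrow>
      conductance n s t \<le> Q * conductance n u v"
    using conductances_comparable by (elim exE conjE)
  have "1 / Q \<le> resistance_ratio V (energy n)" for n
  proof -
    let ?R = "{resistance (energy n) x y | x y. x \<in> V \<and> y \<in> V \<and> x \<noteq> y}"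
    have "Min ?R \<in> ?R" "Max ?R \<in> ?R"
      using Min_in[OF pairs_finite pairs_nonempty] Max_in[OF pairs_finite pairs_nonempty] by blast+
    then obtain s t u v where st: "s \<in> V" "t \<in> V" "s \<noteq> t" "Min ?R = resistance (energy n) s t"
      and uv: "u \<in> V" "v \<in> V" "u \<noteq> v" "Max ?R = resistance (energy n) u v"
      by (smt (verit) mem_Collect_eq)
    have "conductance n s t \<le> Q * conductance n u v" using Q(2) st uv by blast
    then have "1 / Q \<le> conductance n u v / conductance n s t"
      using Q(1) conductance_pos[OF st(1-3), of n] by (simp add: field_simps)
    then show ?thesis
      by (simp add: resistance_ratio_def st(4) uv(4) resistance_energy st(3) uv(3))
  qed
  then show ?thesis using Q(1) by (intro exI[of _ "1 / Q"]) simp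
qed

end

theorem theorem6p3:
  fixes p :: real
    and N :: nat
    and F :: "nat \<Rightarrow> 'a::euclidean_space \<Rightarrow> 'a"
    and K :: "'a set"
    and r :: "nat \<Rightarrow> real"
  assumes "1 < p"
    and "affine_nested_fractal N F K"
    and "\<forall>i\<in>{1..N}. 0 < r i"
    and "symmetric_weights N F K (reflection_group N F K) r"
  shows "\<exists>E\<in>energies p (vertices N F K 0).
           (INF n. resistance_ratio (vertices N F K 0) ((renormalize N F K r ^^ n) E)) > 0"
proof -
  interpret symmetric_renormalized_fractal N F K p r
    using assms by unfold_locales (auto simp: affine_nested_fractal_def)
  obtain c where c: "0 < c" "\<And>n. c \<le> resistance_ratio V (energy n)"
    using resistance_ratio_bounded_below by blast
  have "c \<le> (INF n. resistance_ratio V (energy n))"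
    using c(2) by (intro cINF_greatest) auto
  then have "0 < (INF n. resistance_ratio V ((renormalize N F K r ^^ n) (osc_energy p V)))"
    using c(1) by (simp add: energy_def)
  moreover have "osc_energy p V \<in> energies p V"
    using osc_energy_in_energies[OF p V_finite V_nonempty] .
  ultimately show ?thesis by blast
qed

end
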